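(* Let $d>1$ be an odd squarefree integer and $K=\mathbb{Q}(\sqrt{d})$. Then $K$ has a PWR ideal if and only if there exist positive integers $d_1,d_2$ with $d=d_1d_2$, $d_1<d_2\le 3d_1$, such that the equation \[ k^2d_2-\ell^2d_1=\begin{cases}\pm 2 & \text{if } d\equiv 3 \pmod 4,\\ \pm 4 & \text{if } d\equiv 1\pmod 4\end{cases} \] has a solution in integers $k,\ell$ (for some choice of the sign). Moreover, every primitive PWR ideal $I$ of $K$ is of the form $I_1$ or $I_2$ for such a factorization $d=d_1d_2$, where, writing $d_1=p_1\cdots p_r$ and $d_2=q_1\cdots q_s$ for the prime factorizations, and letting $P$, $P_i$, $Q_j$ denote the unique prime ideals of $O_K$ above $2$, $p_i$, $q_j$ respectively, \[ I_1=PP_1\cdots P_r,\quad I_2=PQ_1\cdots Q_s \ \text{ if } d\equiv 3\pmod 4,\qquad I_1=P_1\cdots P_r,\quad I_2=Q_1\cdots Q_s\ \text{ if } d\equiv 1\pmod 4 \] (an empty product being $O_K$). Moreover, the two ideals $I_1$ and $I_2$ are similar.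
   Context: For a real quadratic field $K=\mathbb{Q}(\sqrt d)$ with ring of integers $O_K$, let $\sigma_1,\sigma_2$ be the two real embeddings ($\sigma_{1,2}(x+y\sqrt d)=x\pm y\sqrt d$) and $\Lambda:K\to\mathbb{R}^2$, $\Lambda(\alpha)=(\sigma_1(\alpha),\sigma_2(\alpha))$. For a nonzero ideal $I\subseteq O_K$, $\Lambda(I)$ is a full-rank lattice in $\mathbb{R}^2$. A lattice $L\subset\mathbb{R}^2$ is well-rounded (WR) if its set of nonzero vectors of minimal Euclidean length spans $\mathbb{R}^2$. An ideal $I$ is WR if $\Lambda(I)$ is WR, and PWR (principal well-rounded) if it is principal and WR. An integral ideal is primitive if it is not of the form $mJ$ with $J$ an integral ideal and $m>1$ a rational integer. Two lattices $L_1,L_2$ are similar if $L_2=\gamma UL_1$ for some real $\gamma>0$ and orthogonal $2\times2$ matrix $U$; two ideals are similar if their images under $\Lambda$ are similar lattices. *)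

theory Defs
  imports
    "HOL-Analysis.Analysis"
    "HOL-Algebra.Ideal_Product"
    "HOL-Computational_Algebra.Computational_Algebra"
begin

text \<open>The field $K = Q(\sqrt d)$ is taken inside the reals, so the embedding
  $\sigma_1$ is the inclusion.\<close>

definition quad_field :: "int \<Rightarrow> real set" where
  "quad_field d = {of_rat x + of_rat y * sqrt (of_int d) | x y. True}"

text \<open>The embedding $\sigma_2$; only meaningful on \<^term>\<open>quad_field d\<close> with \<open>sqrt d\<close>
  irrational, where the coordinates \<open>x\<close>, \<open>y\<close> are unique.\<close>

definition quad_conj :: "int \<Rightarrow> real \<Rightarrow> real" where
  "quad_conj d \<alpha> = (THE \<beta>. \<exists>x y. \<alpha> = of_rat x + of_rat y * sqrt (of_int d)
                              \<and> \<beta> = of_rat x - of_rat y * sqrt (of_int d))"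

definition ring_of_ints :: "int \<Rightarrow> real ring" where
  "ring_of_ints d = \<lparr>carrier = {\<alpha> \<in> quad_field d. algebraic_int \<alpha>},
     monoid.mult = (*), one = 1, ring.zero = 0, add = (+)\<rparr>"

definition Lambda :: "int \<Rightarrow> real \<Rightarrow> real ^ 2" where
  "Lambda d \<alpha> = vector [\<alpha>, quad_conj d \<alpha>]"

definition min_vectors :: "(real ^ 2) set \<Rightarrow> (real ^ 2) set" where
  "min_vectors L = {v \<in> L. v \<noteq> 0 \<and> (\<forall>w\<in>L. w \<noteq> 0 \<longrightarrow> norm v \<le> norm w)}"

definition WR_lattice :: "(real ^ 2) set \<Rightarrow> bool" where
  "WR_lattice L \<longleftrightarrow> span (min_vectors L) = UNIV"

definition similar_lattices :: "(real ^ 2) set \<Rightarrow> (real ^ 2) set \<Rightarrow> bool" where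
  "similar_lattices L1 L2 \<longleftrightarrow>
     (\<exists>(\<gamma>::real) (U :: real ^ 2 ^ 2). \<gamma> > 0 \<and> orthogonal_matrix U \<and> L2 = (\<lambda>v. \<gamma> *\<^sub>R (U *v v)) ` L1)"

definition PWR_ideal :: "int \<Rightarrow> real set \<Rightarrow> bool" where
  "PWR_ideal d I \<longleftrightarrow> principalideal I (ring_of_ints d) \<and> I \<noteq> {0} \<and> WR_lattice (Lambda d ` I)"

definition similar_ideals :: "int \<Rightarrow> real set \<Rightarrow> real set \<Rightarrow> bool" where
  "similar_ideals d I J \<longleftrightarrow> similar_lattices (Lambda d ` I) (Lambda d ` J)"

definition primitive_ideal :: "int \<Rightarrow> real set \<Rightarrow> bool" where
  "primitive_ideal d I \<longleftrightarrow> ideal I (ring_of_ints d) \<and>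
     \<not> (\<exists>(m::int) J. m > 1 \<and> ideal J (ring_of_ints d) \<and> I = (\<lambda>\<alpha>. of_int m * \<alpha>) ` J)"

text \<open>The prime ideal $P$ above $p$, i.e. with $P \cap Z = pZ$. It is used only for primes
  \<open>p\<close> ramified in \<open>K\<close>, where it is unique.\<close>

definition prime_above :: "int \<Rightarrow> int \<Rightarrow> real set" where
  "prime_above d p = (THE P. primeideal P (ring_of_ints d) \<and> P \<inter> \<int> = range (\<lambda>m::int. of_int (p * m)))"

text \<open>For \<open>e = d1\<close> this is the ideal $I_1$, for \<open>e = d2\<close> the ideal $I_2$. The product is taken in
  the monoid of ideals, whose unit is the full ring of integers.\<close>

definition ram_ideal :: "int \<Rightarrow> int \<Rightarrow> real set" where
  "ram_ideal d e =
     (let R = ring_of_ints d;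
          J = (\<Otimes>\<^bsub>ideals_set R\<^esub> p \<in> prime_factors e. prime_above d p)
      in if d mod 4 = 3 then prime_above d 2 \<cdot>\<^bsub>R\<^esub> J else J)"

definition PWR_factorization :: "int \<Rightarrow> int \<Rightarrow> int \<Rightarrow> bool" where
  "PWR_factorization d d1 d2 \<longleftrightarrow>
     d1 > 0 \<and> d2 > 0 \<and> d = d1 * d2 \<and> d1 < d2 \<and> d2 \<le> 3 * d1 \<and>
     (\<exists>k l :: int.
        (d mod 4 = 3 \<longrightarrow> k\<^sup>2 * d2 - l\<^sup>2 * d1 = 2 \<or> k\<^sup>2 * d2 - l\<^sup>2 * d1 = -2) \<and>
        (d mod 4 = 1 \<longrightarrow> k\<^sup>2 * d2 - l\<^sup>2 * d1 = 4 \<or> k\<^sup>2 * d2 - l\<^sup>2 * d1 = -4))"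

end

theory Submission
  imports Defs
begin

text \<open>Put \<open>s = sqrt d\<close>, and let \<open>D\<close> be \<open>2\<close> or \<open>1\<close> according to \<open>d \<equiv> 3\<close> or \<open>d \<equiv> 1\<close> modulo \<open>4\<close>.
  A product of distinct ramified primes with norm \<open>m\<close> is just the set of integers whose norm is
  divisible by \<open>m\<close>, and it is generated by any integer of norm \<open>m\<close> or \<open>-m\<close>.

  Let \<open>\<alpha>O\<close> be well-rounded. Two independent minimal elements \<open>\<alpha>u\<close>, \<open>\<alpha>v\<close> form a lattice basis, so
  \<open>p = u - v\<close> and \<open>q = u + v\<close> satisfy \<open>p q' - p' q = \<plusminus>2Ds\<close>; as the minimal elements have equal length,
  the trace of \<open>\<alpha>\<^sup>2pq\<close> vanishes, so \<open>N(pq')\<close> is \<open>-d\<close> times a square. Together these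
  force \<open>pq' = \<plusminus>Ds\<close> (with an exception for \<open>d = 3\<close>), so that \<open>p\<close> is a rational multiple
  of \<open>sq\<close>, and then one of \<open>\<alpha>p\<close>, \<open>\<alpha>q\<close> is rational. Hence \<open>\<alpha>\<close> is a rational multiple of \<open>p'\<close>
  or \<open>q'\<close>, whose norm is \<open>\<plusminus>De\<close> with \<open>e\<close> dividing \<open>d\<close>. That norm equation is the
  equation of the theorem, and minimality yields the bound on the factors.\<close>

section \<open>Squarefree integers and Gauss's lemma\<close>

text \<open>The cofactor of \<open>gcd m n\<close> in \<open>m\<close> is coprime to the cofactor in
  \<open>n\<close>, hence divides the gcd. Its square then divides the squarefree \<open>m\<close>,
  so it is a unit.\<close>

lemma squarefree_dvd_square:
  fixes m n :: int
  assumes "squarefree m" "m dvd n\<^sup>2"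
  shows "m dvd n"
proof -
  have m0: "m \<noteq> 0" using assms(1) by auto
  obtain m' n' where mn: "m = gcd m n * m'" "n = gcd m n * n'" "Rings.coprime m' n'"
    using gcd_coprime_exists[of m n] m0 by (metis gcd_eq_0_iff mult.commute)
  define g where "g = gcd m n"
  have g0: "g \<noteq> 0" using m0 by (simp add: g_def)
  have m: "m = g * m'" and n: "n = g * n'" using mn by (simp_all add: g_def)
  have "g * m' dvd g * (g * n'\<^sup>2)"
    using assms(2) unfolding m n by (simp add: power2_eq_square mult_ac)
  then have "m' dvd g * n'\<^sup>2" using g0 by simp
  then have "m' dvd g" using mn(3) by (metis coprime_dvd_mult_left_iff coprime_power_right_iff)
  then have "m'\<^sup>2 dvd m" unfolding m power2_eq_square by (simp add: mult_dvd_mono)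
  then have "m' dvd 1" using assms(1) squarefreeD by blast
  then have "m dvd g" unfolding m by (metis dvd_refl dvd_triv_left mult_dvd_mono mult.right_neutral)
  then show ?thesis unfolding n by simp
qed

lemma squarefree_dvd_square_iff:
  fixes m n :: int
  assumes "squarefree m"
  shows "m dvd n\<^sup>2 \<longleftrightarrow> m dvd n"
  by (metis assms squarefree_dvd_square dvd_mult2 power2_eq_square)

text \<open>Gauss's lemma: the primitive part of a quadratic divides a monic annihilator, so its
  leading coefficient is a unit.\<close>

lemma algebraic_int_quadratic_lead_dvd:
  fixes \<alpha> :: real and a b c :: int
  assumes "algebraic_int \<alpha>" and "\<alpha> \<notin> \<rat>" and "a \<noteq> 0"
    and root: "of_int a * \<alpha>\<^sup>2 + of_int b * \<alpha> + of_int c = 0"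
  shows "a dvd b" and "a dvd c"
proof -
  from assms(1) obtain f :: "int poly" where f: "poly (map_poly of_int f) \<alpha> = 0" "lead_coeff f = 1"
    unfolding algebraic_int_altdef_ipoly by blast
  define g where "g = [:c, b, a:]"
  have g0: "g \<noteq> 0" and deg: "degree g = 2" using assms(3) by (simp_all add: g_def)
  \<comment> \<open>Pseudo-division keeps the coefficients integral. The remainder has degree at
    most \<open>1\<close> and vanishes at the irrational \<alpha>, so it is zero.\<close>
  define r where "r = pseudo_mod f g"
  obtain k q where kq: "k \<noteq> 0" "smult k f = g * q + r" and r: "r = 0 \<or> degree r < degree g"
    using pseudo_mod[OF g0, of f] unfolding r_def by blast
  have rg: "poly (map_poly of_int g) \<alpha> = 0"
    using root by (simp add: g_def map_poly_pCons algebra_simps power2_eq_square)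
  have "map_poly of_int (smult k f) = smult (of_int k) (map_poly of_int f :: real poly)"
    by (rule poly_eqI) (simp add: coeff_map_poly)
  then have "poly (map_poly of_int (g * q + r)) \<alpha> = 0"
    using f(1) kq(2) by simp
  moreover have "map_poly of_int (g * q + r)
      = map_poly of_int g * map_poly of_int q + (map_poly of_int r :: real poly)"
    by (rule poly_eqI) (simp add: coeff_map_poly coeff_mult)
  ultimately have pr: "poly (map_poly of_int r) \<alpha> = (0::real)"
    using rg by simp
  have "r = 0"
  proof (rule ccontr)
    assume "r \<noteq> 0"
    then have "degree r \<le> 1" using r deg by auto
    then have "r = [:coeff r 0, coeff r 1:]"
      by (intro poly_eqI) (auto simp: coeff_pCons coeff_eq_0 split: nat.splits)
    then obtain u v where uv: "r = [:u, v:]" by blast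
    have eq: "of_int u + \<alpha> * of_int v = 0" using pr by (simp add: uv map_poly_pCons)
    show False
    proof (cases "v = 0")
      case True
      then show False using eq uv \<open>r \<noteq> 0\<close> by simp
    next
      case False
      then have "\<alpha> = - of_int u / of_int v" using eq by (simp add: field_simps)
      then show False using assms(2) by simp
    qed
  qed
  then have eq: "smult k f = g * q" using kq by simp
  \<comment> \<open>Contents and leading coefficients in \<open>smult k f = g * q\<close>: as
    \<open>f\<close> is monic, \<open>k\<close> equals \<open>C * content q\<close> up to sign,
    while \<open>k = a * lead_coeff q\<close> is a multiple of \<open>a * content q\<close>.
    Cancelling leaves \<open>a dvd C\<close>.\<close>
  define C where "C = content g"
  have q0: "q \<noteq> 0" using eq kq(1) f(2) by auto
  have cf: "content f = 1"
    using content_dvd_coeff[of f "degree f"] f(2) is_unit_content_iff[of f] by metis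
  have "content (smult k f) = content (g * q)" by (simp add: eq)
  then have ck: "normalize k = C * content q"
    by (simp add: content_mult cf C_def)
  have "lead_coeff (smult k f) = lead_coeff g * lead_coeff q" by (simp add: eq lead_coeff_mult)
  then have k1: "k = a * lead_coeff q"
    using f(2) assms(3) kq(1) by (simp add: g_def)
  have "content q dvd lead_coeff q" by simp
  then obtain w where w: "lead_coeff q = content q * w" by (elim dvdE)
  have cq0: "content q \<noteq> 0" using q0 by simp
  have "a * content q dvd k" using k1 w by (simp add: mult.assoc[symmetric])
  then have "a * content q dvd C * content q" using ck by (metis dvd_normalize_iff)
  then have "a dvd C" using cq0 by simp
  moreover have "C dvd b" "C dvd c"
    using content_dvd_coeff[of g 1] content_dvd_coeff[of g 0] by (simp_all add: C_def g_def)
  ultimately show "a dvd b" "a dvd c" using dvd_trans by blast+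
qed

text \<open>If one variable vanishes, parity makes the other even, so its square is at least
  \<open>4\<close>; the ratio bounds say exactly that \<open>4 * e\<close> and \<open>4 * f\<close>
  are at least \<open>e + f\<close>. This is where the factor \<open>3\<close> of the theorem comes
  from.\<close>

lemma binary_form_bound:
  fixes e f x y :: int
  assumes "e > 0" "f > 0" "e \<le> 3 * f" "f \<le> 3 * e" "even (x + y)" "x \<noteq> 0 \<or> y \<noteq> 0"
  shows "e + f \<le> e * x\<^sup>2 + f * y\<^sup>2"
proof -
  have sq: "n \<noteq> 0 \<Longrightarrow> n\<^sup>2 \<ge> 1" for n :: int by (simp add: int_one_le_iff_zero_less)
  have sq4: "n\<^sup>2 \<ge> 4" if "even n" "n \<noteq> 0" for n :: int
  proof -
    obtain k where k: "n = 2 * k" using \<open>even n\<close> by (elim evenE)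
    then show ?thesis using sq[of k] that(2) by simp
  qed
  consider "x \<noteq> 0" "y \<noteq> 0" | "x = 0" "even y" "y \<noteq> 0" | "y = 0" "even x" "x \<noteq> 0"
    using assms(5,6) by fastforce
  then show ?thesis
  proof cases
    case 1
    then have "e * 1 \<le> e * x\<^sup>2" "f * 1 \<le> f * y\<^sup>2"
      using mult_left_mono[OF sq, of x e] mult_left_mono[OF sq, of y f] assms(1,2) by simp_all
    then show ?thesis by simp
  next
    case 2
    then have "f * 4 \<le> e * x\<^sup>2 + f * y\<^sup>2"
      using mult_left_mono[OF sq4, of y f] assms(2) by simp
    then show ?thesis using assms by linarith
  next
    case 3
    then have "e * 4 \<le> e * x\<^sup>2 + f * y\<^sup>2"
      using mult_left_mono[OF sq4, of x e] assms(1) by simp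
    then show ?thesis using assms by linarith
  qed
qed

section \<open>The field and its ring of integers\<close>

locale odd_quadratic_field =
  fixes d :: int
  assumes d_gt_1: "d > 1" and odd_d: "odd d" and squarefree_d: "squarefree d"
begin

abbreviation K :: "real set" where "K \<equiv> quad_field d"
abbreviation conj :: "real \<Rightarrow> real" where "conj \<equiv> quad_conj d"
abbreviation R :: "real ring" where "R \<equiv> ring_of_ints d"
abbreviation \<O> :: "real set" where "\<O> \<equiv> carrier (ring_of_ints d)"

definition s :: real where "s = sqrt (of_int d)"

definition Nm :: "real \<Rightarrow> real" where "Nm z = z * conj z"
definition Tr :: "real \<Rightarrow> real" where "Tr z = z + conj z"

text \<open>\<open>D * s\<close> is the square root of the discriminant.\<close>

definition D :: int where "D = (if d mod 4 = 3 then 2 else 1)"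

lemma d_mod_4: "d mod 4 = 1 \<or> d mod 4 = 3"
  using odd_d by presburger

lemma D_cases: "D = 1 \<and> d mod 4 = 1 \<or> D = 2 \<and> d mod 4 = 3"
  using d_mod_4 by (auto simp: D_def)

lemma D_pos: "D > 0"
  by (simp add: D_def)

lemma d_ge_3: "d \<ge> 3"
  using d_gt_1 odd_d by presburger

lemma s_pos: "s > 0"
  using d_gt_1 by (simp add: s_def)

lemma s_sq: "s * s = of_int d"
  using d_gt_1 by (simp add: s_def)

lemma s_sq': "s * (s * z) = of_int d * z"
  by (simp add: s_sq mult.assoc[symmetric])

lemma s_irrational: "s \<notin> \<rat>"
proof
  assume "s \<in> \<rat>"
  moreover have "algebraic_int s" unfolding s_def by (intro algebraic_int_sqrt) simp
  ultimately have "s \<in> \<int>" using rational_algebraic_int_is_int by blast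
  then obtain m :: int where "s = of_int m" by (auto elim: Ints_cases)
  then have "d = m\<^sup>2" using s_sq by (metis of_int_eq_iff of_int_mult power2_eq_square)
  then have "m dvd 1" using squarefree_d squarefreeD[of d m] by simp
  then have "m\<^sup>2 = 1" by (simp add: abs_square_eq_1)
  then show False using \<open>d = m\<^sup>2\<close> d_gt_1 by simp
qed

text \<open>A squarefree \<open>d\<close> cannot absorb a denominator: \<open>d * y\<close> is a
  root of a monic integral polynomial, hence an integer, and \<open>d\<close> divides its square, so
  \<open>d\<close> divides it.\<close>

lemma rat_square_int:
  fixes y :: real
  assumes "y \<in> \<rat>" "of_int d * y\<^sup>2 \<in> \<int>"
  shows "y \<in> \<int>"
proof -
  obtain m :: int where m: "of_int d * y\<^sup>2 = of_int m" using assms(2) by (auto elim: Ints_cases)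
  have "algebraic_int (of_int d * y)"
  proof
    have "of_int d * y * (of_int d * y) = of_int d * (of_int d * y\<^sup>2)"
      by (simp add: power2_eq_square)
    then show "poly [:- of_int (d * m), 0, 1:] (of_int d * y) = 0"
      by (simp add: m mult.commute)
    show "\<forall>i. coeff [:- real_of_int (d * m), 0, 1:] i \<in> \<int>"
      by (auto simp: coeff_pCons split: nat.splits)
  qed simp
  moreover have "of_int d * y \<in> \<rat>" using assms(1) by simp
  ultimately have "of_int d * y \<in> \<int>" by (rule rational_algebraic_int_is_int)
  then obtain e :: int where e: "of_int d * y = of_int e" by (auto elim: Ints_cases)
  have "of_int (e\<^sup>2) = (of_int (d * m) :: real)"
    using m e by (simp add: power2_eq_square mult_ac flip: e)
  then have "d dvd e\<^sup>2" by (simp only: of_int_eq_iff) simp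
  then have "d dvd e" using squarefree_d squarefree_dvd_square by blast
  then obtain f where "e = d * f" by (elim dvdE)
  then have "y = of_int f" using e d_gt_1 by simp
  then show ?thesis by simp
qed

section \<open>Arithmetic of the field: conjugation, norm and trace\<close>

lemma K_I: "x \<in> \<rat> \<Longrightarrow> y \<in> \<rat> \<Longrightarrow> x + y * s \<in> K"
  by (auto simp: quad_field_def s_def elim!: Rats_cases)

lemma K_E:
  assumes "z \<in> K"
  obtains x y where "x \<in> \<rat>" "y \<in> \<rat>" "z = x + y * s"
  using assms that unfolding quad_field_def s_def[symmetric] by (auto intro: Rats_of_rat)

lemma coordinates_eq:
  assumes "x \<in> \<rat>" "y \<in> \<rat>" "x' \<in> \<rat>" "y' \<in> \<rat>" "x + y * s = x' + y' * s"
  shows "x = x'" "y = y'"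
proof -
  show "y = y'"
  proof (rule ccontr)
    assume "y \<noteq> y'"
    then have "s = (x' - x) / (y - y')" using assms(5) by (simp add: field_simps)
    then show False using assms s_irrational by auto
  qed
  then show "x = x'" using assms(5) by simp
qed

text \<open>Uniqueness of rational coordinates is what makes the description in
  \<open>quad_conj\<close> denote.\<close>

lemma conj_eq:
  assumes "x \<in> \<rat>" "y \<in> \<rat>"
  shows "conj (x + y * s) = x - y * s"
  unfolding quad_conj_def s_def[symmetric]
proof (rule the_equality)
  show "\<exists>x' y'. x + y * s = of_rat x' + of_rat y' * s \<and> x - y * s = of_rat x' - of_rat y' * s"
    using assms by (auto elim!: Rats_cases)
next
  fix \<beta>
  assume "\<exists>x' y'. x + y * s = of_rat x' + of_rat y' * s \<and> \<beta> = of_rat x' - of_rat y' * s"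
  then show "\<beta> = x - y * s" using coordinates_eq[OF assms] by (metis Rats_of_rat)
qed

lemma K_Rats: "x \<in> \<rat> \<Longrightarrow> x \<in> K" and conj_Rats [simp]: "x \<in> \<rat> \<Longrightarrow> conj x = x"
  using K_I[of x 0] conj_eq[of x 0] by simp_all

lemma K_s [simp]: "s \<in> K" and conj_s [simp]: "conj s = - s"
  using K_I[of 0 1] conj_eq[of 0 1] by simp_all

lemma K_of_int [simp]: "of_int n \<in> K" and K_numeral [simp]: "numeral k \<in> K"
  and K_0 [simp]: "0 \<in> K" and K_1 [simp]: "1 \<in> K"
  by (simp_all add: K_Rats)

lemma conj_of_int [simp]: "conj (of_int n) = of_int n"
  and conj_numeral [simp]: "conj (numeral k) = numeral k"
  and conj_0 [simp]: "conj 0 = 0" and conj_1 [simp]: "conj 1 = 1"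
  by simp_all

lemma K_add [simp]: "z \<in> K \<Longrightarrow> w \<in> K \<Longrightarrow> z + w \<in> K"
  and conj_add [simp]: "z \<in> K \<Longrightarrow> w \<in> K \<Longrightarrow> conj (z + w) = conj z + conj w"
proof -
  assume "z \<in> K" "w \<in> K"
  then obtain x y x' y' where *: "x \<in> \<rat>" "y \<in> \<rat>" "z = x + y * s" "x' \<in> \<rat>" "y' \<in> \<rat>" "w = x' + y' * s"
    by (meson K_E)
  have zw: "z + w = (x + x') + (y + y') * s" using * by (simp add: algebra_simps)
  have r: "x + x' \<in> \<rat>" "y + y' \<in> \<rat>" using * by simp_all
  show "z + w \<in> K" unfolding zw using r by (rule K_I)
  show "conj (z + w) = conj z + conj w"
    unfolding zw conj_eq[OF r] using * by (simp add: conj_eq algebra_simps)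
qed

lemma K_mult [simp]: "z \<in> K \<Longrightarrow> w \<in> K \<Longrightarrow> z * w \<in> K"
  and conj_mult [simp]: "z \<in> K \<Longrightarrow> w \<in> K \<Longrightarrow> conj (z * w) = conj z * conj w"
proof -
  assume "z \<in> K" "w \<in> K"
  then obtain x y x' y' where *: "x \<in> \<rat>" "y \<in> \<rat>" "z = x + y * s" "x' \<in> \<rat>" "y' \<in> \<rat>" "w = x' + y' * s"
    by (meson K_E)
  have zw: "z * w = (x * x' + of_int d * y * y') + (x * y' + y * x') * s"
    using * by (simp add: algebra_simps s_sq s_sq')
  have r: "x * x' + of_int d * y * y' \<in> \<rat>" "x * y' + y * x' \<in> \<rat>" using * by simp_all
  show "z * w \<in> K" unfolding zw using r by (rule K_I)
  show "conj (z * w) = conj z * conj w"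
    unfolding zw conj_eq[OF r] using * by (simp add: conj_eq algebra_simps s_sq s_sq')
qed

lemma K_minus [simp]: "z \<in> K \<Longrightarrow> - z \<in> K" and conj_minus [simp]: "z \<in> K \<Longrightarrow> conj (- z) = - conj z"
  using K_mult[of "-1" z] conj_mult[of "-1" z] K_Rats[of "-1"] conj_Rats[of "-1"] by simp_all

lemma K_diff [simp]: "z \<in> K \<Longrightarrow> w \<in> K \<Longrightarrow> z - w \<in> K"
  and conj_diff [simp]: "z \<in> K \<Longrightarrow> w \<in> K \<Longrightarrow> conj (z - w) = conj z - conj w"
  using K_add[of z "- w"] conj_add[of z "- w"] by simp_all

lemma K_conj [simp]: "z \<in> K \<Longrightarrow> conj z \<in> K" and conj_conj [simp]: "z \<in> K \<Longrightarrow> conj (conj z) = z"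
proof -
  assume "z \<in> K"
  then obtain x y where *: "x \<in> \<rat>" "y \<in> \<rat>" "z = x + y * s" by (rule K_E)
  then have "conj z = x + (- y) * s" by (simp add: conj_eq del: conj_add)
  then show "conj z \<in> K" "conj (conj z) = z"
    using * K_I[of x "- y"] conj_eq[of x "- y"] by simp_all
qed

lemma conj_eq_0_iff [simp]: "z \<in> K \<Longrightarrow> conj z = 0 \<longleftrightarrow> z = 0"
  using conj_conj[of z] by fastforce

lemma Nm_Rats: "z \<in> K \<Longrightarrow> Nm z \<in> \<rat>" and Tr_Rats: "z \<in> K \<Longrightarrow> Tr z \<in> \<rat>"
  by (auto elim!: K_E simp: Nm_def Tr_def conj_eq algebra_simps s_sq s_sq' simp del: conj_add conj_mult)

lemma Nm_eq_0_iff: "z \<in> K \<Longrightarrow> Nm z = 0 \<longleftrightarrow> z = 0"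
  by (simp add: Nm_def)

lemma Nm_mult: "z \<in> K \<Longrightarrow> w \<in> K \<Longrightarrow> Nm (z * w) = Nm z * Nm w"
  by (simp add: Nm_def)

lemma Nm_conj: "z \<in> K \<Longrightarrow> Nm (conj z) = Nm z"
  by (simp add: Nm_def mult.commute)

lemma K_inverse [simp]: "z \<in> K \<Longrightarrow> inverse z \<in> K"
  and conj_inverse [simp]: "z \<in> K \<Longrightarrow> conj (inverse z) = inverse (conj z)"
proof -
  assume z: "z \<in> K"
  have eq: "inverse z = conj z * inverse (Nm z)"
    using z by (cases "z = 0") (simp_all add: Nm_def)
  have r: "inverse (Nm z) \<in> \<rat>" using Nm_Rats[OF z] by simp
  show "inverse z \<in> K" unfolding eq using z r K_Rats by simp
  show "conj (inverse z) = inverse (conj z)"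
    unfolding eq using z r K_Rats by (cases "z = 0") (simp_all add: Nm_def)
qed

lemma K_divide [simp]: "z \<in> K \<Longrightarrow> w \<in> K \<Longrightarrow> z / w \<in> K"
  and conj_divide [simp]: "z \<in> K \<Longrightarrow> w \<in> K \<Longrightarrow> conj (z / w) = conj z / conj w"
  by (simp_all add: divide_inverse)

lemma conj_fixed: "z \<in> K \<Longrightarrow> conj z = z \<Longrightarrow> z \<in> \<rat>"
  using s_pos by (auto elim!: K_E simp: conj_eq simp del: conj_add)

lemma Tr_eq_0:
  assumes "z \<in> K" "Tr z = 0"
  obtains r where "r \<in> \<rat>" "z = r * s"
  using assms by (auto elim!: K_E simp: Tr_def conj_eq simp del: conj_add)

section \<open>Integers of the field: trace and norm criterion, coordinates\<close>

lemma quad_root: "z \<in> K \<Longrightarrow> z\<^sup>2 - Tr z * z + Nm z = 0"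
  by (simp add: Tr_def Nm_def power2_eq_square algebra_simps)

text \<open>Clearing denominators in \<open>quad_root\<close> gives an integral quadratic with root
  \<open>z\<close>. For irrational \<open>z\<close>, Gauss's lemma makes its leading coefficient
  divide the others, so both denominators disappear; a rational \<open>z\<close> is an ordinary
  integer.\<close>

lemma O_iff: "z \<in> \<O> \<longleftrightarrow> z \<in> K \<and> Tr z \<in> \<int> \<and> Nm z \<in> \<int>"
proof (cases "z \<in> K")
  case zK: True
  have "algebraic_int z \<longleftrightarrow> Tr z \<in> \<int> \<and> Nm z \<in> \<int>"
  proof
    assume z: "Tr z \<in> \<int> \<and> Nm z \<in> \<int>"
    show "algebraic_int z"
    proof
      show "poly [:Nm z, - Tr z, 1:] z = 0"
        using quad_root[OF zK] by (simp add: power2_eq_square algebra_simps)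
      show "\<forall>i. coeff [:Nm z, - Tr z, 1:] i \<in> \<int>"
        using z by (auto simp: coeff_pCons split: nat.splits)
    qed simp
  next
    assume z: "algebraic_int z"
    show "Tr z \<in> \<int> \<and> Nm z \<in> \<int>"
    proof (cases "z \<in> \<rat>")
      case True
      then have "z \<in> \<int>" using z rational_algebraic_int_is_int by blast
      then show ?thesis using True by (simp add: Tr_def Nm_def)
    next
      case False
      obtain t k where t: "k > 0" "Tr z = of_int t / of_int k"
        using Tr_Rats[OF zK] by (auto elim: Rats_cases')
      obtain n l where n: "l > 0" "Nm z = of_int n / of_int l"
        using Nm_Rats[OF zK] by (auto elim: Rats_cases')
      have tk: "of_int t = of_int k * Tr z" and nl: "of_int n = of_int l * Nm z"
        using t n by simp_all
      have "of_int (k * l) * z\<^sup>2 + of_int (- t * l) * z + of_int (n * k)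
          = of_int k * of_int l * (z\<^sup>2 - Tr z * z + Nm z)"
        by (simp add: tk nl algebra_simps)
      then have root: "of_int (k * l) * z\<^sup>2 + of_int (- t * l) * z + of_int (n * k) = 0"
        using quad_root[OF zK] by simp
      have "k * l \<noteq> 0" using t n by simp
      note dvd = algebraic_int_quadratic_lead_dvd[OF z False this root]
      have "k dvd t" "l dvd n" using dvd t(1) n(1) by (simp_all add: mult.commute[of k])
      then show ?thesis using t n by auto
    qed
  qed
  then show ?thesis using zK by (simp add: ring_of_ints_def)
qed (simp add: ring_of_ints_def)

text \<open>The factor \<open>D / 2\<close> covers both residues of \<open>d\<close>: for
  \<open>D = 2\<close> the integers are \<open>x + y * s\<close>, for \<open>D = 1\<close> they are
  the halves of such numbers with \<open>x\<close> and \<open>y\<close> of equal parity. Doubled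
  coordinates are integral by \<open>rat_square_int\<close>.\<close>

lemma O_coordinates:
  assumes "z \<in> \<O>"
  obtains x y :: int where "z = of_int D / 2 * (of_int x + of_int y * s)" "D = 1 \<Longrightarrow> even (x + y)"
proof -
  have zK: "z \<in> K" and T: "Tr z \<in> \<int>" and N: "Nm z \<in> \<int>" using assms O_iff by auto
  obtain x y where xy: "x \<in> \<rat>" "y \<in> \<rat>" "z = x + y * s" using zK by (rule K_E)
  have cz: "conj z = x - y * s" using xy by (simp add: conj_eq del: conj_add)
  have Tx: "Tr z = 2 * x" and Nx: "Nm z = x * x - of_int d * (y * y)"
    unfolding Tr_def Nm_def cz using xy(3) by (simp_all add: algebra_simps s_sq s_sq')
  obtain t :: int where t: "2 * x = of_int t" using T Tx by (metis Ints_cases)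
  obtain n :: int where n: "x * x - of_int d * (y * y) = of_int n" using N Nx by (metis Ints_cases)
  have "of_int d * (2 * y)\<^sup>2 = (2 * x)\<^sup>2 - 4 * of_int n"
    using n by (simp add: power2_eq_square algebra_simps)
  then have dy: "of_int d * (2 * y)\<^sup>2 = of_int (t\<^sup>2 - 4 * n)" using t by simp
  have "2 * y \<in> \<int>" by (rule rat_square_int) (use xy dy in auto)
  then obtain w :: int where w: "2 * y = of_int w" by (auto elim: Ints_cases)
  have "of_int (d * w\<^sup>2) = (of_int (t\<^sup>2 - 4 * n) :: real)" using dy w by simp
  then have tw: "t\<^sup>2 - d * w\<^sup>2 = 4 * n" by (simp only: of_int_eq_iff)
  have z: "z = (of_int t + of_int w * s) / 2" using xy(3) t w by (simp add: field_simps)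
  have par: "even t \<longleftrightarrow> even w"
  proof -
    have "t\<^sup>2 = d * w\<^sup>2 + 2 * (2 * n)" using tw by simp
    then have "even (t\<^sup>2) \<longleftrightarrow> even (d * w\<^sup>2)" by simp
    then show ?thesis using odd_d by simp
  qed
  show ?thesis
  proof (cases "D = 1")
    case True
    show ?thesis by (rule that[of t w]) (use z par True in auto)
  next
    case False
    then have D2: "D = 2" "d mod 4 = 3" using D_cases by auto
    \<comment> \<open>Odd \<open>t\<close> and \<open>w\<close> would give
      \<open>t^2 - d * w^2\<close> congruent to \<open>1 - 3\<close>, that is to \<open>2\<close>,
      modulo \<open>4\<close>.\<close>
    have "even t"
    proof (rule ccontr)
      assume "odd t"
      then obtain a b where ab: "t = 2 * a + 1" "w = 2 * b + 1" using par by (meson oddE)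
      obtain c where c: "d = 4 * c + 3" using D2(2) by (metis mult_div_mod_eq)
      have "4 * (a * a + a) + 1 - (4 * c + 3) * (4 * (b * b + b) + 1) = 4 * n"
        using tw unfolding ab c by (simp add: power2_eq_square algebra_simps)
      then have "4 * (a * a + a - c * (4 * (b * b + b) + 1) - 3 * (b * b + b) - n) = 2"
        by (simp add: algebra_simps)
      then show False by presburger
    qed
    then obtain a b where ab: "t = 2 * a" "w = 2 * b" using par by (meson evenE)
    show ?thesis by (rule that[of a b]) (use z D2 ab in auto)
  qed
qed

lemma coordinates_in_O:
  assumes "D = 1 \<Longrightarrow> even (x + y)"
  shows "of_int D / 2 * (of_int x + of_int y * s) \<in> \<O>"
proof -
  define z where "z = of_int D / 2 * (of_int x + of_int y * s)"
  have eq: "z = (of_int (D * x) / 2) + (of_int (D * y) / 2) * s" by (simp add: z_def field_simps)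
  have zK: "z \<in> K" unfolding eq by (intro K_I) auto
  have cz: "conj z = (of_int (D * x) / 2) - (of_int (D * y) / 2) * s"
    unfolding eq by (intro conj_eq) auto
  have T: "Tr z = of_int (D * x)" unfolding Tr_def cz unfolding eq by simp
  have N: "Nm z = of_int (D\<^sup>2 * (x\<^sup>2 - d * y\<^sup>2)) / 4"
    unfolding Nm_def cz unfolding eq by (simp add: field_simps s_sq s_sq' power2_eq_square)
  have "4 dvd D\<^sup>2 * (x\<^sup>2 - d * y\<^sup>2)"
  proof (cases "D = 1")
    case True
    then have "even (x - y)" "d mod 4 = 1" using assms D_cases by auto
    then obtain a c where a: "x = y + 2 * a" and c: "d = 4 * c + 1"
      by (metis diff_add_cancel add.commute evenE mult_div_mod_eq)
    have "x\<^sup>2 - d * y\<^sup>2 = 4 * (a * y + a * a - c * y * y)"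
      unfolding a c by (simp add: power2_eq_square algebra_simps)
    then show ?thesis using True by simp
  next
    case False
    then have "D = 2" using D_cases by auto
    then show ?thesis by simp
  qed
  then obtain k where "D\<^sup>2 * (x\<^sup>2 - d * y\<^sup>2) = 4 * k" by (elim dvdE)
  then have "Nm z = of_int k" using N by simp
  then show ?thesis using zK T unfolding O_iff z_def[symmetric] by simp
qed

lemma coordinates_Nm_Tr:
  fixes x y :: int
  defines "z \<equiv> of_int D / 2 * (of_int x + of_int y * s)"
  shows "Tr z = of_int (D * x)" and "4 * Nm z = of_int (D\<^sup>2 * (x\<^sup>2 - d * y\<^sup>2))"
    and "conj z = of_int D / 2 * (of_int x - of_int y * s)"
proof -
  show c: "conj z = of_int D / 2 * (of_int x - of_int y * s)"
    unfolding z_def by simp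
  show "Tr z = of_int (D * x)" unfolding Tr_def c unfolding z_def by (simp add: field_simps)
  show "4 * Nm z = of_int (D\<^sup>2 * (x\<^sup>2 - d * y\<^sup>2))"
    unfolding Nm_def c unfolding z_def by (simp add: field_simps s_sq s_sq' power2_eq_square)
qed


section \<open>Products of ramified primes\<close>

lemma R_simps [simp]:
  "x \<otimes>\<^bsub>R\<^esub> y = x * y" "x \<oplus>\<^bsub>R\<^esub> y = x + y" "\<one>\<^bsub>R\<^esub> = 1" "\<zero>\<^bsub>R\<^esub> = 0"
  by (simp_all add: ring_of_ints_def)

lemma O_K [simp]: "z \<in> \<O> \<Longrightarrow> z \<in> K"
  by (simp add: O_iff)

lemma O_of_int [simp]: "of_int n \<in> \<O>"
  unfolding O_iff Tr_def Nm_def by simp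

lemma O_0 [simp]: "0 \<in> \<O>" and O_1 [simp]: "1 \<in> \<O>" and O_numeral [simp]: "numeral k \<in> \<O>"
  using O_of_int[of 0] O_of_int[of 1] O_of_int[of "numeral k"] by simp_all

lemma O_s [simp]: "s \<in> \<O>"
  unfolding O_iff Tr_def Nm_def by (simp add: s_sq)

lemma O_conj [simp]: "z \<in> \<O> \<Longrightarrow> conj z \<in> \<O>"
  unfolding O_iff Tr_def Nm_def by (simp add: add.commute mult.commute)

lemma O_add [simp]: "z \<in> \<O> \<Longrightarrow> w \<in> \<O> \<Longrightarrow> z + w \<in> \<O>"
proof -
  assume "z \<in> \<O>" "w \<in> \<O>"
  then obtain x y x' y' :: int
    where z: "z = of_int D / 2 * (of_int x + of_int y * s)" "D = 1 \<Longrightarrow> even (x + y)"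
      and w: "w = of_int D / 2 * (of_int x' + of_int y' * s)" "D = 1 \<Longrightarrow> even (x' + y')"
    by (meson O_coordinates)
  have "z + w = of_int D / 2 * (of_int (x + x') + of_int (y + y') * s)"
    using z w by (simp add: algebra_simps)
  moreover have "D = 1 \<Longrightarrow> even ((x + x') + (y + y'))" using z w by presburger
  ultimately show ?thesis using coordinates_in_O by metis
qed

lemma O_mult [simp]: "z \<in> \<O> \<Longrightarrow> w \<in> \<O> \<Longrightarrow> z * w \<in> \<O>"
proof -
  assume zw: "z \<in> \<O>" "w \<in> \<O>"
  then obtain x y x' y' :: int
    where z: "z = of_int D / 2 * (of_int x + of_int y * s)" "D = 1 \<Longrightarrow> even (x + y)"
      and w: "w = of_int D / 2 * (of_int x' + of_int y' * s)" "D = 1 \<Longrightarrow> even (x' + y')"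
    by (meson O_coordinates)
  have "conj (z * w) = conj z * conj w" using zw by simp
  then have c: "conj (z * w) = of_int D / 2 * (of_int x - of_int y * s) * (of_int D / 2 * (of_int x' - of_int y' * s))"
    by (simp only: coordinates_Nm_Tr(3)[of x y, folded z(1)] coordinates_Nm_Tr(3)[of x' y', folded w(1)])
  have T: "Tr (z * w) = of_int (D\<^sup>2 * (x * x' + d * y * y')) / 2"
    unfolding Tr_def c unfolding z(1) w(1) by (simp add: field_simps s_sq s_sq' power2_eq_square)
  \<comment> \<open>For \<open>D = 1\<close> the parities agree within each pair and
    \<open>d\<close> is odd, so the two products have equal parity; for \<open>D = 2\<close> the
    factor \<open>D^2\<close> suffices. The norm needs no such care, being multiplicative.\<close>
  have "even (D\<^sup>2 * (x * x' + d * y * y'))"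
    using z(2) w(2) D_cases odd_d by auto
  then obtain k where k: "D\<^sup>2 * (x * x' + d * y * y') = 2 * k" by (elim evenE)
  have "Tr (z * w) = of_int k" unfolding T k by simp
  then have "Tr (z * w) \<in> \<int>" by simp
  then show ?thesis using zw unfolding O_iff by (simp add: Nm_mult)
qed

lemma O_minus [simp]: "z \<in> \<O> \<Longrightarrow> - z \<in> \<O>"
  using O_mult[of "- 1" z] O_of_int[of "- 1"] by simp

lemma O_diff [simp]: "z \<in> \<O> \<Longrightarrow> w \<in> \<O> \<Longrightarrow> z - w \<in> \<O>"
  using O_add[of z "- w"] by simp

section \<open>The ring structure and elementary criteria for ideals\<close>

lemma cring_R: "cring R"
proof (rule cringI)
  show "abelian_group R"
  proof (rule abelian_groupI)
    fix x assume "x \<in> \<O>"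
    then show "\<exists>y\<in>\<O>. y \<oplus>\<^bsub>R\<^esub> x = \<zero>\<^bsub>R\<^esub>" by (intro bexI[of _ "- x"]) simp_all
  qed simp_all
  show "comm_monoid R" by (rule comm_monoidI) simp_all
qed (simp add: algebra_simps)

lemma ring_R: "ring R"
  using cring_R by (simp add: cring_def)

lemma add_monoid_inv: "x \<in> \<O> \<Longrightarrow> inv\<^bsub>add_monoid R\<^esub> x = - x"
  using group.inv_equality[OF abelian_group.a_group[OF ring.is_abelian_group[OF ring_R]], of "- x" x]
  by simp

lemma ideal_R_I:
  assumes "I \<subseteq> \<O>" "0 \<in> I" "\<And>x y. x \<in> I \<Longrightarrow> y \<in> I \<Longrightarrow> x + y \<in> I" "\<And>x r. x \<in> I \<Longrightarrow> r \<in> \<O> \<Longrightarrow> r * x \<in> I"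
  shows "ideal I R"
proof (rule idealI[OF ring_R])
  show "subgroup I (add_monoid R)"
  proof (rule group.subgroupI[OF abelian_group.a_group[OF ring.is_abelian_group[OF ring_R]]])
    fix a assume a: "a \<in> I"
    have "- 1 * a \<in> I" by (rule assms(4)[OF a]) (use O_of_int[of "-1"] in simp)
    then show "inv\<^bsub>add_monoid R\<^esub> a \<in> I" using a assms(1) add_monoid_inv by auto
  qed (use assms in auto)
qed (use assms(4) in \<open>auto simp: mult.commute\<close>)

lemma ideal_RD:
  assumes "ideal I R"
  shows "I \<subseteq> \<O>" "0 \<in> I" "x \<in> I \<Longrightarrow> y \<in> I \<Longrightarrow> x + y \<in> I" "x \<in> I \<Longrightarrow> r \<in> \<O> \<Longrightarrow> r * x \<in> I"
    "x \<in> I \<Longrightarrow> - x \<in> I"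
proof -
  interpret I: ideal I R by fact
  show "I \<subseteq> \<O>" by (rule I.a_subset)
  show "0 \<in> I" using additive_subgroup.zero_closed[OF I.is_additive_subgroup] by simp
  show "x \<in> I \<Longrightarrow> y \<in> I \<Longrightarrow> x + y \<in> I" 
    using additive_subgroup.a_closed[OF I.is_additive_subgroup] by simp
  show r: "x \<in> I \<Longrightarrow> r \<in> \<O> \<Longrightarrow> r * x \<in> I" for r using I.I_l_closed by simp
  show "x \<in> I \<Longrightarrow> - x \<in> I" using r[of "-1"] O_of_int[of "-1"] by simp
qed

lemma principalideal_R_iff:
  "principalideal I R \<longleftrightarrow> (\<exists>\<alpha>\<in>\<O>. I = {x * \<alpha> | x. x \<in> \<O>})"
proof -
  interpret R: cring R by (rule cring_R)
  have eq: "PIdl\<^bsub>R\<^esub> \<alpha> = {x * \<alpha> | x. x \<in> \<O>}" for \<alpha> by (simp add: cgenideal_def)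
  show ?thesis
    using R.cgenideal_is_principalideal R.cgenideal_eq_genideal eq
    by (metis principalideal.generate)
qed

text \<open>For \<open>m\<close> dividing the squarefree number \<open>D * d\<close> this is the product of the primes above
  the prime factors of \<open>m\<close>, all of which ramify.\<close>

definition J :: "int \<Rightarrow> real set" where
  "J m = {z \<in> \<O>. \<exists>k::int. Nm z = of_int (m * k)}"

lemma squarefree_D_d: "squarefree (D * d)"
proof (cases "D = 1")
  case False
  then have "D = 2" using D_cases by auto
  moreover have "Rings.coprime 2 d" using odd_d by simp
  moreover have "squarefree (2::int)" by (rule squarefree_prime) simp
  ultimately show ?thesis using squarefree_mult_coprime squarefree_d by metis
qed (simp add: squarefree_d)

lemma J_O: "z \<in> J m \<Longrightarrow> z \<in> \<O>"
  by (simp add: J_def)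

lemma O_Nm_Ints:
  assumes "z \<in> \<O>"
  obtains n :: int where "Nm z = of_int n"
  using assms O_iff by (metis Ints_cases)

lemma J_iff: "Nm z = of_int n \<Longrightarrow> z \<in> J m \<longleftrightarrow> z \<in> \<O> \<and> m dvd n"
  by (auto simp: J_def dvd_def simp flip: of_int_mult)

text \<open>Ramification enters here: the square of \<open>Tr z\<close> is \<open>4 * Nm z\<close>
  plus a multiple of \<open>D * d\<close>, so \<open>m\<close> divides it, and a squarefree
  \<open>m\<close> then divides the trace itself.\<close>

lemma J_Tr:
  assumes "z \<in> J m" "m dvd D * d"
  obtains k :: int where "Tr z = of_int (m * k)"
proof -
  have "z \<in> \<O>" using assms by (rule_tac J_O)
  then obtain x y :: int where z: "z = of_int D / 2 * (of_int x + of_int y * s)"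
    by (rule O_coordinates)
  note c = coordinates_Nm_Tr(1,2)[of x y, folded z]
  obtain k where k: "Nm z = of_int (m * k)" using assms by (auto simp: J_def)
  have "of_int (4 * (m * k)) = (of_int (D\<^sup>2 * (x\<^sup>2 - d * y\<^sup>2)) :: real)" using c(2) k by simp
  then have "4 * (m * k) = D\<^sup>2 * (x\<^sup>2 - d * y\<^sup>2)" by (simp only: of_int_eq_iff)
  then have "(D * x)\<^sup>2 = m * (4 * k) + D * d * (D * y\<^sup>2)"
    by (simp add: power2_eq_square algebra_simps)
  then have "m dvd (D * x)\<^sup>2" using assms(2) by (simp add: dvd_mult2)
  then have "m dvd D * x"
    using squarefree_mono[OF assms(2) squarefree_D_d] squarefree_dvd_square by blast
  then obtain k where "D * x = m * k" by (elim dvdE)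
  then show ?thesis using c(1) that[of k] by simp
qed

lemma J_mult: "z \<in> J m \<Longrightarrow> r \<in> \<O> \<Longrightarrow> r * z \<in> J m"
proof -
  assume z: "z \<in> J m" and r: "r \<in> \<O>"
  obtain k where k: "Nm z = of_int (m * k)" using z by (auto simp: J_def)
  obtain n where n: "Nm r = of_int n" using r by (rule O_Nm_Ints)
  have zO: "z \<in> \<O>" using z by (rule J_O)
  have "Nm (r * z) = of_int (m * (n * k))" using zO r k n by (simp add: Nm_mult)
  moreover have "r * z \<in> \<O>" using zO r by simp
  ultimately show ?thesis unfolding J_def by blast
qed

text \<open>The cross term in the norm of a sum is \<open>Tr (conj w * z)\<close>. Its argument lies
  in \<open>J m\<close> again, so \<open>J_Tr\<close> controls it.\<close>

lemma J_add:
  assumes "m dvd D * d" "z \<in> J m" "w \<in> J m"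
  shows "z + w \<in> J m"
proof -
  have O: "z \<in> \<O>" "w \<in> \<O>" using assms J_O by auto
  obtain k where k: "Nm z = of_int (m * k)" using assms by (auto simp: J_def)
  obtain l where l: "Nm w = of_int (m * l)" using assms by (auto simp: J_def)
  have "conj w * z \<in> J m" using assms O J_mult by simp
  then obtain t where t: "Tr (conj w * z) = of_int (m * t)" using assms(1) J_Tr by blast
  have "Nm (z + w) = Nm z + Nm w + Tr (conj w * z)"
    using O by (simp add: Nm_def Tr_def algebra_simps)
  then have "Nm (z + w) = of_int (m * (k + l + t))" using k l t by (simp add: algebra_simps)
  moreover have "z + w \<in> \<O>" using O by simp
  ultimately show ?thesis unfolding J_def by blast
qed

lemma ideal_J: "m dvd D * d \<Longrightarrow> ideal (J m) R"
proof (rule ideal_R_I)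
  show "0 \<in> J m" unfolding J_def by (auto simp: Nm_def intro: exI[of _ 0])
qed (use J_O J_add J_mult in auto)

lemma J_1: "J 1 = \<O>"
  by (auto simp: J_def elim: O_Nm_Ints)

lemma of_int_in_J_iff: "squarefree m \<Longrightarrow> of_int n \<in> J m \<longleftrightarrow> m dvd n"
  using J_iff[of "of_int n" "n\<^sup>2" m] squarefree_dvd_square_iff[of m n]
  by (simp add: Nm_def power2_eq_square)

lemma primeideal_J:
  assumes p: "Factorial_Ring.prime p" and "p dvd D * d"
  shows "primeideal (J p) R"
proof (rule primeidealI[OF ideal_J[OF assms(2)] cring_R])
  have "\<not> p dvd 1" using p not_prime_unit by blast
  then have "1 \<notin> J p" using of_int_in_J_iff[OF squarefree_prime[OF p], of 1] by simp
  then show "\<O> \<noteq> J p" using O_1 by metis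
next
  fix a b assume ab: "a \<in> \<O>" "b \<in> \<O>" "a \<otimes>\<^bsub>R\<^esub> b \<in> J p"
  obtain m n where mn: "Nm a = of_int m" "Nm b = of_int n" using ab O_Nm_Ints by metis
  have "Nm (a * b) = of_int (m * n)" using ab mn by (simp add: Nm_mult)
  then have "p dvd m * n" using ab(3) J_iff[of "a * b" "m * n" p] by simp
  then have "p dvd m \<or> p dvd n" using p by (simp add: prime_dvd_mult_iff)
  then show "a \<in> J p \<or> b \<in> J p" using ab J_iff[OF mn(1)] J_iff[OF mn(2)] by blast
qed

lemma J_Int_Ints:
  assumes "squarefree m"
  shows "J m \<inter> \<int> = range (\<lambda>k::int. of_int (m * k))"
proof (intro equalityI subsetI)
  fix z assume z: "z \<in> J m \<inter> \<int>"
  then obtain n where n: "z = of_int n" by (meson IntD2 Ints_cases)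
  then obtain k where "n = m * k" using z of_int_in_J_iff[OF assms, of n] by (auto elim: dvdE)
  then show "z \<in> range (\<lambda>k::int. of_int (m * k))" using n by blast
next
  fix z :: real assume "z \<in> range (\<lambda>k::int. of_int (m * k))"
  then obtain k where "z = of_int (m * k)" by blast
  then show "z \<in> J m \<inter> \<int>" using of_int_in_J_iff[OF assms, of "m * k"] Ints_of_int by simp
qed

text \<open>Uniqueness: for \<open>z\<close> in a prime \<open>P\<close> above \<open>p\<close>, the
  norm of \<open>z\<close> lies in \<open>P\<close> and is an integer, hence a multiple of
  \<open>p\<close>. Conversely, for \<open>z\<close> in \<open>J p\<close> both trace and norm are
  multiples of \<open>p\<close>, so \<open>z * z = z * Tr z - Nm z\<close> lies in \<open>P\<close>,
  and so does \<open>z\<close>.\<close>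

lemma prime_above_eq_J:
  assumes p: "Factorial_Ring.prime p" and "p dvd D * d"
  shows "prime_above d p = J p"
  unfolding prime_above_def
proof (rule the_equality)
  have sqf: "squarefree p" using p squarefree_prime by blast
  then show "primeideal (J p) R \<and> J p \<inter> \<int> = range (\<lambda>m::int. of_int (p * m))"
    using primeideal_J[OF assms] J_Int_Ints by blast
  fix P assume P: "primeideal P R \<and> P \<inter> \<int> = range (\<lambda>m::int. of_int (p * m))"
  interpret P: primeideal P R using P by blast
  note P_simps = ideal_RD[OF P.is_ideal]
  show "P = J p"
  proof (intro equalityI subsetI)
    fix z assume z: "z \<in> P"
    then have zO: "z \<in> \<O>" using P_simps(1) by (rule_tac subsetD)
    have "conj z * z \<in> P" using z zO by (intro P_simps(4)) simp_all
    moreover obtain n where n: "Nm z = of_int n" using zO by (rule O_Nm_Ints)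
    ultimately have "of_int n \<in> P \<inter> \<int>" by (simp add: Nm_def mult.commute)
    then show "z \<in> J p" using P zO n by (auto simp: J_def)
  next
    fix z assume z: "z \<in> J p"
    then have zO: "z \<in> \<O>" by (rule J_O)
    obtain t where t: "Tr z = of_int (p * t)" using z assms(2) by (rule J_Tr)
    obtain n where n: "Nm z = of_int (p * n)" using z by (auto simp: J_def)
    have in_P: "of_int (p * k) \<in> P" for k using P by blast
    have "z * Tr z + - Nm z \<in> P" unfolding t n
      by (intro P_simps(3) P_simps(4) P_simps(5) in_P zO)
    moreover have "z * Tr z + - Nm z = z * z"
      using zO by (simp add: Tr_def Nm_def algebra_simps)
    ultimately show "z \<in> P" using P.I_prime[of z z] zO by simp
  qed
qed

text \<open>A Bezout relation makes the two ideals comaximal, so their product is their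
  intersection. Coprime numbers both divide a norm exactly when their product does.\<close>

lemma J_prod:
  assumes "Rings.coprime m n" "m * n dvd D * d"
  shows "J m \<cdot>\<^bsub>R\<^esub> J n = J (m * n)"
proof -
  interpret R: cring R by (rule cring_R)
  have dvd: "m dvd D * d" "n dvd D * d" using assms(2) dvd_mult_left dvd_mult_right by blast+
  have sqf: "squarefree m" "squarefree n" using dvd squarefree_D_d squarefree_mono by blast+
  note id = ideal_J[OF dvd(1)] ideal_J[OF dvd(2)]
  obtain a b where ab: "a * m + b * n = 1" using assms(1) by (metis bezout_int coprime_iff_gcd_eq_1)
  have "J m <+>\<^bsub>R\<^esub> J n = \<O>"
  proof (intro equalityI subsetI)
    fix z assume z: "z \<in> \<O>"
    have "z = z * of_int (a * m) + z * of_int (b * n)"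
      using ab by (simp flip: distrib_left of_int_mult of_int_add)
    moreover have "z * of_int (a * m) \<in> J m" "z * of_int (b * n) \<in> J n"
      using z of_int_in_J_iff sqf by (intro J_mult; simp del: of_int_mult)+
    ultimately show "z \<in> J m <+>\<^bsub>R\<^esub> J n" unfolding set_add_def' by auto
  qed (auto simp: set_add_def' intro!: O_add dest: J_O)
  then have "J m \<cdot>\<^bsub>R\<^esub> J n = J m \<inter> J n" by (intro R.ideal_prod_eq_inter id)
  also have "\<dots> = J (m * n)"
  proof (intro Set.set_eqI)
    fix z
    show "z \<in> J m \<inter> J n \<longleftrightarrow> z \<in> J (m * n)"
    proof (cases "z \<in> \<O>")
      case True
      then obtain k where k: "Nm z = of_int k" by (rule O_Nm_Ints)
      have "m * n dvd k \<longleftrightarrow> m dvd k \<and> n dvd k"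
        using assms(1) by (auto intro: divides_mult dvd_mult_left dvd_mult_right)
      then show ?thesis using J_iff[OF k] True by auto
    qed (auto dest: J_O)
  qed
  finally show ?thesis .
qed

lemma finprod_primes_above:
  assumes "finite S" "\<And>p. p \<in> S \<Longrightarrow> Factorial_Ring.prime p" "\<Prod>S dvd D * d"
  shows "(\<Otimes>\<^bsub>ideals_set R\<^esub> p \<in> S. prime_above d p) = J (\<Prod>S)"
proof -
  interpret R: cring R by (rule cring_R)
  interpret M: comm_monoid "ideals_set R" by (rule R.ideals_set_is_comm_monoid)
  show ?thesis
    using assms
  proof (induction S rule: finite_induct)
    case empty
    have "\<one>\<^bsub>ideals_set R\<^esub> = \<O>" by (simp add: ideals_set_def)
    then show ?case by (simp add: J_1)
  next
    case (insert p S)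
    have dvd: "p * \<Prod>S dvd D * d" using insert by simp
    then have dvd': "p dvd D * d" "\<Prod>S dvd D * d" using dvd_mult_left dvd_mult_right by blast+
    have prime: "Factorial_Ring.prime p" using insert by blast
    have qd: "q dvd D * d" if "q \<in> S" for q
      using dvd_prodI[OF insert(1) that, of "\<lambda>x. x"] dvd' dvd_trans by blast
    have qJ: "prime_above d q \<in> carrier (ideals_set R)" if "q \<in> insert p S" for q
      using that prime_above_eq_J[of q] ideal_J[of q] qd dvd' insert.prems(1)
      by (auto simp: ideals_set_def)
    have "(\<Otimes>\<^bsub>ideals_set R\<^esub> q \<in> insert p S. prime_above d q)
        = prime_above d p \<cdot>\<^bsub>R\<^esub> (\<Otimes>\<^bsub>ideals_set R\<^esub> q \<in> S. prime_above d q)"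
      using insert(1,2) qJ by (subst M.finprod_insert) (auto simp: ideals_set_def)
    also have "\<dots> = J p \<cdot>\<^bsub>R\<^esub> J (\<Prod>S)"
      using insert prime prime_above_eq_J dvd' by simp
    also have "\<dots> = J (p * \<Prod>S)"
    proof (rule J_prod[OF _ dvd])
      show "Rings.coprime p (\<Prod>S)"
        using insert by (intro prod_coprime_right primes_coprime) auto
    qed
    finally show ?case using insert by simp
  qed
qed

lemma prod_prime_factors_squarefree:
  fixes e :: int
  assumes "squarefree e" "e > 0"
  shows "\<Prod>(prime_factors e) = e"
proof -
  have "\<Prod>(prime_factors e) = (\<Prod>p\<in>prime_factors e. p ^ multiplicity p e)"
    using assms squarefree_factorial_semiring'[of e] by (intro prod.cong) auto
  also have "\<dots> = e" using prod_prime_factors[of e] assms by simp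
  finally show ?thesis .
qed

text \<open>The factor \<open>D\<close> accounts for the additional prime above \<open>2\<close>
  when \<open>d mod 4 = 3\<close>; it is coprime to the odd number \<open>e\<close>, so
  \<open>J_prod\<close> applies.\<close>

lemma ram_ideal_eq_J:
  assumes "e dvd d" "e > 0"
  shows "ram_ideal d e = J (D * e)"
proof -
  have dvd: "e dvd D * d" "D * e dvd D * d" using assms by simp_all
  have sqf: "squarefree e" using squarefree_mono[OF assms(1) squarefree_d] .
  have prod: "(\<Otimes>\<^bsub>ideals_set R\<^esub> p \<in> prime_factors e. prime_above d p) = J e"
    using finprod_primes_above[of "prime_factors e"] dvd(1) in_prime_factors_imp_prime
    unfolding prod_prime_factors_squarefree[OF sqf assms(2)] by blast
  show ?thesis
  proof (cases "D = 1")
    case True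
    then show ?thesis unfolding ram_ideal_def Let_def prod by (simp add: D_def split: if_splits)
  next
    case False
    then have D2: "D = 2" "d mod 4 = 3" using D_cases by auto
    have "prime_above d 2 = J 2" using D2 by (intro prime_above_eq_J) simp_all
    moreover have "odd e" using assms(1) odd_d by auto
    ultimately show ?thesis
      using dvd(2) D2 J_prod[of 2 e] unfolding ram_ideal_def Let_def prod by simp
  qed
qed

text \<open>For \<open>z\<close> in \<open>J m\<close> the quotient of \<open>z\<close> by \<beta>
  is \<open>conj \<beta> * z / Nm \<beta>\<close>. The numerator lies in \<open>J m\<close>, so its
  trace is divisible by \<open>m\<close>, and its norm is \<open>Nm \<beta>\<close> times a multiple
  of \<open>m\<close>; the quotient therefore has integral trace and norm.\<close>

lemma J_eq_principal:
  assumes "m dvd D * d" "m > 0" "\<beta> \<in> \<O>" "\<bar>Nm \<beta>\<bar> = of_int m"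
  shows "J m = {x * \<beta> | x. x \<in> \<O>}"
proof -
  have Nm: "Nm \<beta> = of_int m \<or> Nm \<beta> = of_int (- m)" using assms(4) by auto
  then have \<beta>: "\<beta> \<in> J m" using assms(3) J_iff by fastforce
  have "z \<in> {x * \<beta> | x. x \<in> \<O>}" if z: "z \<in> J m" for z
  proof -
    define w where "w = conj \<beta> * z"
    have zO: "z \<in> \<O>" using z by (rule J_O)
    have w: "w \<in> J m" unfolding w_def using J_mult z assms(3) by simp
    obtain t where t: "Tr w = of_int (m * t)" using w assms(1) by (rule J_Tr)
    obtain k where k: "Nm z = of_int (m * k)" using z by (auto simp: J_def)
    have wK: "w \<in> K" using w J_O by simp
    have "Nm (w / Nm \<beta>) = Nm w / (Nm \<beta> * Nm \<beta>)" "Tr (w / Nm \<beta>) = Tr w / Nm \<beta>"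
      using Nm_Rats[of \<beta>] wK assms(3) K_Rats[of "Nm \<beta>"]
      unfolding Nm_def[of w] Nm_def[of "w / Nm \<beta>"] Tr_def by (simp_all add: add_divide_distrib)
    moreover have "Nm w = Nm \<beta> * of_int (m * k)"
      unfolding w_def using assms(3) zO k by (simp add: Nm_mult Nm_conj)
    ultimately have "Nm (w / Nm \<beta>) \<in> \<int>" "Tr (w / Nm \<beta>) \<in> \<int>"
      using Nm t assms(2) by auto
    then have "w / Nm \<beta> \<in> \<O>" using wK Nm_Rats[of \<beta>] K_Rats assms(3) unfolding O_iff by simp
    moreover have "z = w / Nm \<beta> * \<beta>"
      using Nm assms(2) unfolding w_def by (auto simp: Nm_def)
    ultimately show ?thesis by blast
  qed
  then show ?thesis using J_mult[OF \<beta>] by blast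
qed

section \<open>Well-roundedness and similarity\<close>

text \<open>The squared Euclidean length of \<open>Lambda d z\<close>, which lets minimality be
  treated inside the field.\<close>

definition qf :: "real \<Rightarrow> real" where "qf z = z\<^sup>2 + (conj z)\<^sup>2"

definition minimal_elements :: "real set \<Rightarrow> real set" where
  "minimal_elements I = {z \<in> I. z \<noteq> 0 \<and> (\<forall>w\<in>I. w \<noteq> 0 \<longrightarrow> qf z \<le> qf w)}"

lemma norm_Lambda: "norm (Lambda d z) = sqrt (qf z)"
  by (simp add: Lambda_def qf_def norm_eq_sqrt_inner inner_vec_def sum_2 power2_eq_square)

lemma Lambda_eq_0_iff: "z \<in> K \<Longrightarrow> Lambda d z = 0 \<longleftrightarrow> z = 0"
  by (auto simp: Lambda_def vec_eq_iff forall_2)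

lemma min_vectors_Lambda:
  assumes "I \<subseteq> K"
  shows "min_vectors (Lambda d ` I) = Lambda d ` minimal_elements I"
  using assms Lambda_eq_0_iff
  by (auto simp: min_vectors_def minimal_elements_def norm_Lambda subset_iff)

text \<open>\<open>u * conj v - v * conj u\<close> is the determinant of the images of
  \<open>u\<close> and \<open>v\<close>. If it vanished for a fixed minimal \<open>u\<close> and all
  minimal \<open>v\<close>, the span would lie in a line, which misses the vector with coordinates
  \<open>1\<close> and \<open>0\<close>.\<close>

lemma WR_lattice_Lambda_iff:
  assumes "I \<subseteq> K"
  shows "WR_lattice (Lambda d ` I) \<longleftrightarrow>
    (\<exists>u\<in>minimal_elements I. \<exists>v\<in>minimal_elements I. u * conj v \<noteq> v * conj u)"
proof
  assume "WR_lattice (Lambda d ` I)"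
  then have span: "span (Lambda d ` minimal_elements I) = UNIV"
    using min_vectors_Lambda[OF assms] by (simp add: WR_lattice_def)
  have "minimal_elements I \<noteq> {}"
  proof
    assume "minimal_elements I = {}"
    then have "(UNIV :: (real ^ 2) set) = {0}" using span by simp
    then have "(vector [1, 0] :: real ^ 2) = 0" by blast
    then show False by (simp add: vec_eq_iff forall_2)
  qed
  then obtain u where u: "u \<in> minimal_elements I" by blast
  then have u0: "conj u \<noteq> 0" using assms by (auto simp: minimal_elements_def)
  show "\<exists>u\<in>minimal_elements I. \<exists>v\<in>minimal_elements I. u * conj v \<noteq> v * conj u"
  proof (rule ccontr)
    assume contra: "\<not> ?thesis"
    have par: "u * conj v = v * conj u" if "v \<in> minimal_elements I" for v
      using contra u that by blast
    have "Lambda d ` minimal_elements I \<subseteq> {x. u * x $ 2 - x $ 1 * conj u = 0}"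
    proof (intro image_subsetI CollectI)
      fix v assume "v \<in> minimal_elements I"
      then show "u * Lambda d v $ 2 - Lambda d v $ 1 * conj u = 0"
        unfolding Lambda_def vector_2 by (simp only: par diff_self)
    qed
    moreover have "subspace {x :: real ^ 2. u * x $ 2 - x $ 1 * conj u = 0}"
    proof (rule subspaceI)
      fix x y :: "real ^ 2" and r
      have "u * (x + y) $ 2 - (x + y) $ 1 * conj u
          = (u * x $ 2 - x $ 1 * conj u) + (u * y $ 2 - y $ 1 * conj u)"
        by (simp add: algebra_simps)
      then show "x \<in> {x. u * x $ 2 - x $ 1 * conj u = 0} \<Longrightarrow> y \<in> {x. u * x $ 2 - x $ 1 * conj u = 0}
          \<Longrightarrow> x + y \<in> {x. u * x $ 2 - x $ 1 * conj u = 0}" by simp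
      have "u * (r *\<^sub>R x) $ 2 - (r *\<^sub>R x) $ 1 * conj u = r * (u * x $ 2 - x $ 1 * conj u)"
        by (simp add: algebra_simps)
      then show "x \<in> {x. u * x $ 2 - x $ 1 * conj u = 0}
          \<Longrightarrow> r *\<^sub>R x \<in> {x. u * x $ 2 - x $ 1 * conj u = 0}" by simp
    qed simp
    ultimately have "UNIV \<subseteq> {x :: real ^ 2. u * x $ 2 - x $ 1 * conj u = 0}"
      unfolding span[symmetric] by (rule span_minimal)
    then have "(vector [1, 0] :: real ^ 2) \<in> {x. u * x $ 2 - x $ 1 * conj u = 0}" by blast
    then show False using u0 by simp
  qed
next
  assume "\<exists>u\<in>minimal_elements I. \<exists>v\<in>minimal_elements I. u * conj v \<noteq> v * conj u"
  then obtain u v where uv: "u \<in> minimal_elements I" "v \<in> minimal_elements I"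
    and ne: "u * conj v - v * conj u \<noteq> 0" by auto
  have "x \<in> span (Lambda d ` minimal_elements I)" for x
  proof -
    define \<delta> where "\<delta> = u * conj v - v * conj u"
    \<comment> \<open>Cramer's rule for the coefficients of \<open>x\<close> in the basis given by
      \<open>u\<close> and \<open>v\<close>.\<close>
    define a where "a = (x $ 1 * conj v - x $ 2 * v) / \<delta>"
    define b where "b = (x $ 2 * u - x $ 1 * conj u) / \<delta>"
    have "a * u + b * v = x $ 1 * (u * conj v - v * conj u) / \<delta>"
      unfolding a_def b_def by (simp add: diff_divide_distrib algebra_simps)
    then have 1: "a * u + b * v = x $ 1" using ne by (simp add: \<delta>_def)
    have "a * conj u + b * conj v = x $ 2 * (u * conj v - v * conj u) / \<delta>"
      unfolding a_def b_def by (simp add: diff_divide_distrib algebra_simps)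
    then have 2: "a * conj u + b * conj v = x $ 2" using ne by (simp add: \<delta>_def)
    have "x = a *\<^sub>R Lambda d u + b *\<^sub>R Lambda d v"
      using 1 2 by (simp add: vec_eq_iff forall_2 Lambda_def)
    also have "\<dots> \<in> span (Lambda d ` minimal_elements I)"
      using uv by (intro span_add span_scale span_base imageI)
    finally show ?thesis .
  qed
  then show "WR_lattice (Lambda d ` I)"
    unfolding WR_lattice_def min_vectors_Lambda[OF assms] by blast
qed

section \<open>The ideals \<open>J (D * e)\<close> as planar lattices\<close>

lemma coordinates_qf:
  fixes x y :: int
  shows "qf (of_int D / 2 * (of_int x + of_int y * s)) = of_int (D\<^sup>2 * (x\<^sup>2 + d * y\<^sup>2)) / 2"
  unfolding qf_def coordinates_Nm_Tr(3)
  by (simp add: field_simps s_sq s_sq' power2_eq_square)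

text \<open>These two conjugate elements turn out to be minimal under the bounds of
  \<open>WR_lattice_J\<close>. Their norm is \<open>D * e\<close> times a quarter of
  \<open>D * (e - f)\<close>; that quarter is integral because both factors are odd and, for
  \<open>D = 1\<close>, congruent modulo \<open>4\<close>.\<close>

lemma coordinates_in_J:
  assumes d: "d = e * f" and y: "y = 1 \<or> y = - 1"
  shows "of_int D / 2 * (of_int e + of_int y * s) \<in> J (D * e)"
proof -
  have odd: "odd e" "odd f" using odd_d d by auto
  define z where "z = of_int D / 2 * (of_int e + of_int y * s)"
  have zO: "z \<in> \<O>" unfolding z_def by (rule coordinates_in_O) (use odd y in auto)
  have "4 dvd D * (e - f)"
  proof (cases "D = 1")
    case True
    then have "d mod 4 = 1" using D_cases by auto
    then have "e * f mod 4 = 1" using d by simp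
    moreover have "e mod 4 = 1 \<or> e mod 4 = 3" "f mod 4 = 1 \<or> f mod 4 = 3" using odd by presburger+
    ultimately have "e mod 4 = f mod 4" by (auto simp: mod_mult_eq[of e 4 f, symmetric])
    then show ?thesis using True by (simp add: mod_eq_dvd_iff)
  next
    case False
    then have "D = 2" using D_cases by auto
    then show ?thesis using odd by (auto elim!: oddE)
  qed
  then obtain k where k: "D * (e - f) = 4 * k" by (elim dvdE)
  have "4 * Nm z = of_int (D\<^sup>2 * (e\<^sup>2 - d * y\<^sup>2))" unfolding z_def by (rule coordinates_Nm_Tr)
  also have "D\<^sup>2 * (e\<^sup>2 - d * y\<^sup>2) = (D * e) * (D * (e - f))"
    using y d by (auto simp: power2_eq_square algebra_simps)
  finally have "Nm z = of_int (D * e * k)" unfolding k by simp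
  then show ?thesis using zO unfolding z_def[symmetric] J_def by blast
qed

text \<open>Divisibility of the norm by \<open>D * e\<close> puts a factor \<open>e\<close> into the
  rational coordinate, and what remains forces equal parities. The squared length thus becomes a
  constant times \<open>e * x^2 + f * y^2\<close>, the form in
  \<open>binary_form_bound\<close>.\<close>

lemma J_coordinates:
  assumes d: "d = e * f" and "e > 0" and zJ: "z \<in> J (D * e)"
  obtains x y :: int where "z = of_int D / 2 * (of_int (e * x) + of_int y * s)" "even (x + y)"
proof -
  have odd: "odd e" "odd f" using odd_d d by auto
  obtain k where k: "Nm z = of_int (D * e * k)" using zJ by (auto simp: J_def)
  obtain x y :: int where z: "z = of_int D / 2 * (of_int x + of_int y * s)"
    using J_O[OF zJ] by (rule O_coordinates)
  have "of_int (4 * (D * e * k)) = (of_int (D\<^sup>2 * (x\<^sup>2 - d * y\<^sup>2)) :: real)"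
    using coordinates_Nm_Tr(2)[of x y, folded z] k by simp
  then have "4 * (D * e * k) = D\<^sup>2 * (x\<^sup>2 - d * y\<^sup>2)" by (simp only: of_int_eq_iff)
  then have "D * (4 * (e * k)) = D * (D * (x\<^sup>2 - d * y\<^sup>2))"
    by (simp add: power2_eq_square algebra_simps)
  then have eq: "4 * (e * k) = D * (x\<^sup>2 - d * y\<^sup>2)" using D_pos by simp
  then have "D * x\<^sup>2 = e * (4 * k + D * f * y\<^sup>2)" by (simp add: d algebra_simps)
  then have "e dvd D * x\<^sup>2" by simp
  moreover have "Rings.coprime e D" using odd D_cases by auto
  ultimately have "e dvd x\<^sup>2" by (simp add: coprime_dvd_mult_right_iff)
  moreover have "squarefree e" using squarefree_d d squarefree_multD(1) by blast
  ultimately have "e dvd x" using squarefree_dvd_square by blast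
  then obtain X where X: "x = e * X" by (elim dvdE)
  have "e * (4 * k) = e * (D * (e * X\<^sup>2 - f * y\<^sup>2))"
    using eq by (simp add: X d power2_eq_square algebra_simps)
  then have k4: "4 * k = D * (e * X\<^sup>2 - f * y\<^sup>2)" using assms(2) by simp
  have "even (e * X\<^sup>2 - f * y\<^sup>2)"
  proof (cases "D = 1")
    case True
    then have "e * X\<^sup>2 - f * y\<^sup>2 = 2 * (2 * k)" using k4 by simp
    then show ?thesis by (metis dvd_triv_left)
  next
    case False
    then have "e * X\<^sup>2 - f * y\<^sup>2 = 2 * k" using k4 D_cases by auto
    then show ?thesis by (metis dvd_triv_left)
  qed
  then have "even (X + y)" using odd by simp
  then show ?thesis using that z X by blast
qed

text \<open>The coordinate pairs \<open>(1, 1)\<close> and \<open>(1, -1)\<close> attain the bound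
  of \<open>binary_form_bound\<close>. The corresponding elements are conjugate, so their
  determinant is \<open>u * u - v * v\<close>, a nonzero multiple of \<open>s\<close>.\<close>

lemma WR_lattice_J:
  assumes d: "d = e * f" and pos: "e > 0" "f > 0" and "e \<le> 3 * f" "f \<le> 3 * e"
  shows "WR_lattice (Lambda d ` J (D * e))"
proof -
  define u where "u = of_int D / 2 * (of_int e + of_int 1 * s)"
  define v where "v = of_int D / 2 * (of_int e + of_int (- 1) * s)"
  have uJ: "u \<in> J (D * e)" unfolding u_def by (rule coordinates_in_J[OF d]) simp
  have vJ: "v \<in> J (D * e)" unfolding v_def by (rule coordinates_in_J[OF d]) simp
  have qu: "qf u = of_int (D\<^sup>2 * (e\<^sup>2 + d)) / 2" "qf v = of_int (D\<^sup>2 * (e\<^sup>2 + d)) / 2"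
    unfolding u_def v_def coordinates_qf by simp_all
  have min: "of_int (D\<^sup>2 * (e\<^sup>2 + d)) / 2 \<le> qf w" if w: "w \<in> J (D * e)" "w \<noteq> 0" for w
  proof -
    obtain x y :: int where xy: "w = of_int D / 2 * (of_int (e * x) + of_int y * s)" "even (x + y)"
      using d pos(1) w(1) by (rule J_coordinates)
    have "x \<noteq> 0 \<or> y \<noteq> 0" using xy(1) w(2) by auto
    then have "e + f \<le> e * x\<^sup>2 + f * y\<^sup>2" using assms xy(2) by (intro binary_form_bound)
    then have "(D\<^sup>2 * e) * (e + f) \<le> (D\<^sup>2 * e) * (e * x\<^sup>2 + f * y\<^sup>2)"
      using pos by (intro mult_left_mono) simp_all
    then have "D\<^sup>2 * (e\<^sup>2 + d) \<le> D\<^sup>2 * ((e * x)\<^sup>2 + d * y\<^sup>2)"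
      by (simp add: d power2_eq_square algebra_simps)
    then show ?thesis unfolding xy(1) coordinates_qf by (simp only: of_int_le_iff divide_right_mono zero_le_numeral)
  qed
  have pos': "of_int (D\<^sup>2 * (e\<^sup>2 + d)) / 2 > (0::real)"
    using D_pos d_gt_1 by (simp add: add_nonneg_pos)
  then have "qf u \<noteq> 0" "qf v \<noteq> 0" using qu by auto
  then have "u \<noteq> 0" "v \<noteq> 0" by (auto simp: qf_def)
  then have M: "u \<in> minimal_elements (J (D * e))" "v \<in> minimal_elements (J (D * e))"
    using uJ vJ min unfolding minimal_elements_def mem_Collect_eq qu by blast+
  have "conj u = v" "conj v = u"
    unfolding u_def v_def coordinates_Nm_Tr(3) by simp_all
  moreover have "u * u - v * v = of_int (D\<^sup>2 * e) * s"
    by (simp add: u_def v_def field_simps power2_eq_square)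
  moreover have "of_int (D\<^sup>2 * e) * s \<noteq> 0" using D_pos pos s_pos by simp
  ultimately have "u * conj v \<noteq> v * conj u" by auto
  moreover have "J (D * e) \<subseteq> K" using J_O O_K by blast
  ultimately show ?thesis using M WR_lattice_Lambda_iff by blast
qed

text \<open>Multiplication by \<open>s / e\<close> exchanges the two coordinates, taking
  \<open>e * x + y * s\<close> to \<open>f * y + x * s\<close>, and multiplies the norm by
  \<open>- f / e\<close>.\<close>

lemma J_mult_s:
  assumes d: "d = e * f" and "e > 0" and z: "z \<in> J (D * e)"
  shows "s * z / of_int e \<in> J (D * f)"
proof -
  obtain x y :: int where xy: "z = of_int D / 2 * (of_int (e * x) + of_int y * s)" "even (x + y)"
    using assms by (rule J_coordinates)
  have rd: "real_of_int d = of_int e * of_int f" by (simp add: d)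
  have "s * z / of_int e = of_int D / 2 * (of_int (f * y) + of_int x * s)"
    unfolding xy(1) using assms(2) by (simp add: field_simps s_sq s_sq' rd)
  also have "\<dots> \<in> J (D * f)"
  proof -
    define w where "w = of_int D / 2 * (of_int (f * y) + of_int x * s)"
    have odd: "odd e" "odd f" using odd_d d by auto
    have wO: "w \<in> \<O>" unfolding w_def using xy(2) odd by (intro coordinates_in_O) simp
    obtain k where k: "Nm z = of_int (D * e * k)" using z by (auto simp: J_def)
    have "4 * Nm w = of_int (D\<^sup>2 * ((f * y)\<^sup>2 - d * x\<^sup>2))" unfolding w_def by (rule coordinates_Nm_Tr)
    moreover have "4 * Nm z = of_int (D\<^sup>2 * ((e * x)\<^sup>2 - d * y\<^sup>2))" unfolding xy(1) by (rule coordinates_Nm_Tr)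
    moreover have "e * (D\<^sup>2 * ((f * y)\<^sup>2 - d * x\<^sup>2)) = - f * (D\<^sup>2 * ((e * x)\<^sup>2 - d * y\<^sup>2))"
      by (simp add: d power2_eq_square algebra_simps)
    ultimately have "of_int e * (4 * Nm w) = - of_int f * (4 * Nm z)"
      by (metis of_int_minus of_int_mult)
    then have "of_int e * Nm w = of_int e * of_int (D * f * (- k))" using k by (simp add: algebra_simps)
    then have "Nm w = of_int (D * f * (- k))"
      using assms(2) by (simp only: mult_cancel_left of_int_eq_0_iff) simp
    then show ?thesis using wO unfolding w_def[symmetric] J_def by blast
  qed
  finally show ?thesis .
qed

text \<open>Multiplication by \<open>s / e\<close> carries one ideal onto the other, with inverse
  multiplication by \<open>s / f\<close>. Since \<open>conj s = - s\<close>, on the lattices it is a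
  scaling combined with the reflection of the second axis.\<close>

lemma similar_ideals_J:
  assumes d: "d = e * f" and pos: "e > 0" "f > 0"
  shows "similar_ideals d (J (D * e)) (J (D * f))"
proof -
  define \<gamma> where "\<gamma> = s / of_int e"
  define U :: "real ^ 2 ^ 2" where "U = vector [vector [1, 0], vector [0, - 1]]"
  have "\<gamma> > 0" using s_pos pos by (simp add: \<gamma>_def)
  moreover have "orthogonal_matrix U"
    by (simp add: orthogonal_matrix U_def matrix_matrix_mult_def transpose_def mat_def vec_eq_iff forall_2 sum_2)
  moreover have "Lambda d ` J (D * f) = (\<lambda>v. \<gamma> *\<^sub>R (U *v v)) ` Lambda d ` J (D * e)"
  proof -
    have eq: "Lambda d (s * z / of_int e) = \<gamma> *\<^sub>R (U *v Lambda d z)" if "z \<in> J (D * e)" for z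
      using O_K[OF J_O[OF that]]
      by (simp add: Lambda_def \<gamma>_def U_def vec_eq_iff forall_2 matrix_vector_mult_def sum_2)
    have rd: "real_of_int d = of_int e * of_int f" by (simp add: d)
    have "J (D * f) = (\<lambda>z. s * z / of_int e) ` J (D * e)"
    proof (intro equalityI subsetI)
      fix w assume w: "w \<in> J (D * f)"
      have "s * w / of_int f \<in> J (D * e)" by (rule J_mult_s) (use d pos w in auto)
      moreover have "w = s * (s * w / of_int f) / of_int e"
        using pos by (simp add: s_sq' rd)
      ultimately show "w \<in> (\<lambda>z. s * z / of_int e) ` J (D * e)" by blast
    qed (use J_mult_s[OF d pos(1)] in blast)
    then show ?thesis using eq by (force simp: image_image)
  qed
  ultimately show ?thesis unfolding similar_ideals_def similar_lattices_def by blast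
qed

text \<open>The ideal contains an element whose coefficient of \<open>s\<close> is
  \<open>D / 2\<close>, so integrality of its multiple by \<open>c\<close> forces \<open>c\<close>
  to be an integer. The sign of \<open>c\<close> is absorbed by the ideal, and primitivity excludes
  absolute values above \<open>1\<close>.\<close>

lemma primitive_multiple_of_J:
  assumes d: "d = e * f" and "e > 0" and c: "c \<in> \<rat>" "c \<noteq> 0"
    and I: "I = (\<lambda>z. c * z) ` J (D * e)" and prim: "primitive_ideal d I"
  shows "I = J (D * e)"
proof -
  define u where "u = of_int D / 2 * (of_int e + of_int 1 * s)"
  have idJ: "ideal (J (D * e)) R" by (rule ideal_J) (simp add: d)
  have "u \<in> J (D * e)" unfolding u_def by (rule coordinates_in_J[OF d]) simp
  then have "c * u \<in> \<O>" using prim I ideal_RD(1) unfolding primitive_ideal_def by blast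
  then obtain x y :: int where xy: "c * u = of_int D / 2 * (of_int x + of_int y * s)" by (rule O_coordinates)
  then have "of_int D / 2 * (c * of_int e + c * s) = of_int D / 2 * (of_int x + of_int y * s)"
    by (simp add: u_def algebra_simps)
  then have "c * of_int e + c * s = of_int x + of_int y * s"
    using D_pos by simp
  then have cy: "c = of_int y" using coordinates_eq(2)[of "c * of_int e" c "of_int x" "of_int y"] c by simp
  have neg: "(\<lambda>z. - z) ` J (D * e) = J (D * e)"
    using ideal_RD(5)[OF idJ] by (force simp: image_iff)
  have I': "I = (\<lambda>z. of_int \<bar>y\<bar> * z) ` J (D * e)"
  proof (cases "y \<ge> 0")
    case False
    have "I = (\<lambda>z. c * z) ` (\<lambda>z. - z) ` J (D * e)" unfolding neg by (rule I)
    then show ?thesis using False cy by (simp add: image_image)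
  qed (simp add: I cy)
  then have "\<not> \<bar>y\<bar> > 1" using prim idJ unfolding primitive_ideal_def by blast
  moreover have "y \<noteq> 0" using c cy by auto
  ultimately have "\<bar>y\<bar> = 1" by linarith
  then show ?thesis using I' by simp
qed


section \<open>Well-rounded principal ideals\<close>

text \<open>Rounding the real coefficients of \<open>w\<close> leaves a lattice element with
  coefficients of absolute value at most one half. It is strictly shorter than the minimum, hence
  zero.\<close>

lemma minimal_elements_basis:
  assumes "ideal I R" and u: "u \<in> minimal_elements I" and v: "v \<in> minimal_elements I"
    and indep: "u * conj v \<noteq> v * conj u" and w: "w \<in> I"
  obtains m n :: int where "w = of_int m * u + of_int n * v"
proof -
  note I = ideal_RD[OF assms(1)]
  have uI: "u \<in> I" and vI: "v \<in> I" using u v by (simp_all add: minimal_elements_def)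
  have K: "u \<in> K" "v \<in> K" "w \<in> K" using subsetD[OF I(1)] uI vI w O_K by blast+
  define M where "M = qf u"
  have vM: "qf v = M"
    using u v unfolding M_def minimal_elements_def by (auto intro!: order.antisym)
  have ge: "M \<le> qf z" if "z \<in> I" "z \<noteq> 0" for z
    using u that by (simp add: minimal_elements_def M_def)
  define \<delta> where "\<delta> = u * conj v - v * conj u"
  have \<delta>: "\<delta> \<noteq> 0" using indep by (simp add: \<delta>_def)
  define a where "a = (w * conj v - conj w * v) / \<delta>"
  define b where "b = (conj w * u - w * conj u) / \<delta>"
  have "a * u + b * v = w * \<delta> / \<delta>"
    unfolding a_def b_def by (simp add: \<delta>_def diff_divide_distrib algebra_simps)
  then have w1: "w = a * u + b * v" using \<delta> by simp
  have "a * conj u + b * conj v = conj w * \<delta> / \<delta>"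
    unfolding a_def b_def by (simp add: \<delta>_def diff_divide_distrib algebra_simps)
  then have w2: "conj w = a * conj u + b * conj v" using \<delta> by simp
  define m where "m = round a"
  define n where "n = round b"
  define x where "x = a - of_int m"
  define y where "y = b - of_int n"
  have xy: "\<bar>x\<bar> \<le> 1 / 2" "\<bar>y\<bar> \<le> 1 / 2"
    using of_int_round_abs_le[of a] of_int_round_abs_le[of b]
    by (simp_all add: x_def y_def m_def n_def abs_minus_commute)
  define z where "z = w - (of_int m * u + of_int n * v)"
  have mun: "of_int m * u + of_int n * v \<in> I" using uI vI I(3,4) by simp
  then have zI: "z \<in> I" unfolding z_def using I(3)[OF w I(5)] by fastforce
  have z1: "z = x * u + y * v" using w1 by (simp add: z_def x_def y_def algebra_simps)
  have "conj z = conj w - (of_int m * conj u + of_int n * conj v)" unfolding z_def using K by simp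
  then have z2: "conj z = x * conj u + y * conj v" using w2 by (simp add: x_def y_def algebra_simps)
  \<comment> \<open>\<open>c\<close> is the inner product of the two minimal vectors. Lagrange's
    identity gives the strict Cauchy-Schwarz inequality, which makes the final estimate
    strict.\<close>
  define c where "c = u * v + conj u * conj v"
  have "M * M = qf u * qf v" using vM by (simp add: M_def)
  then have "M * M - c * c = \<delta>\<^sup>2"
    by (simp add: qf_def c_def \<delta>_def power2_eq_square algebra_simps)
  then have "c\<^sup>2 < M\<^sup>2" using \<delta> by (simp add: power2_eq_square) (metis diff_gt_0_iff_gt not_real_square_gt_zero)
  moreover have M0: "M \<ge> 0" by (simp add: M_def qf_def)
  ultimately have cM: "\<bar>c\<bar> < M" by (metis abs_of_nonneg power2_less_imp_less power2_abs)
  have "z = 0"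
  proof (rule ccontr)
    assume "z \<noteq> 0"
    then have "M \<le> qf z" using ge zI by blast
    also have "qf z = x\<^sup>2 * qf u + y\<^sup>2 * qf v + 2 * (x * y * c)"
      unfolding qf_def[of z] z2 unfolding z1 by (simp add: qf_def c_def power2_eq_square algebra_simps)
    also have "\<dots> = x\<^sup>2 * M + y\<^sup>2 * M + 2 * (x * y * c)" by (simp add: vM M_def)
    also have "\<dots> < M"
    proof -
      have "x\<^sup>2 \<le> (1 / 2)\<^sup>2" "y\<^sup>2 \<le> (1 / 2)\<^sup>2" using xy by (metis abs_ge_zero power2_abs power_mono)+
      then have "x\<^sup>2 * M \<le> 1 / 4 * M" "y\<^sup>2 * M \<le> 1 / 4 * M"
        using mult_right_mono[OF _ M0, of "x\<^sup>2" "1 / 4"] mult_right_mono[OF _ M0, of "y\<^sup>2" "1 / 4"]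
        by (simp_all add: power_divide)
      moreover have "x * y * c \<le> 1 / 4 * \<bar>c\<bar>"
      proof -
        have "\<bar>x\<bar> * \<bar>y\<bar> \<le> 1 / 2 * (1 / 2)" using xy by (intro mult_mono) auto
        then have "\<bar>x\<bar> * \<bar>y\<bar> * \<bar>c\<bar> \<le> 1 / 4 * \<bar>c\<bar>" by (intro mult_right_mono) auto
        then show ?thesis using abs_ge_self[of "x * y * c"] by (simp add: abs_mult)
      qed
      ultimately show ?thesis using cM by linarith
    qed
    finally show False by simp
  qed
  then show ?thesis using that[of m n] by (simp add: z_def)
qed

text \<open>The determinant of \<open>u\<close>, \<open>v\<close> is an integral multiple
  \<open>y\<close> of \<open>D * s\<close>, while \<open>1\<close> and \<omega> have determinant
  \<open>- D * s\<close>. Expressing the latter pair in the former makes \<open>y\<close> a divisor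
  of \<open>1\<close>.\<close>

lemma O_basis_determinant:
  assumes "u \<in> \<O>" "v \<in> \<O>" and basis: "\<And>z. z \<in> \<O> \<Longrightarrow> \<exists>m n::int. z = of_int m * u + of_int n * v"
  obtains y :: int where "u * conj v - v * conj u = of_int (D * y) * s" "y = 1 \<or> y = - 1"
proof -
  define \<omega> where "\<omega> = of_int D / 2 * (of_int 1 + of_int 1 * s)"
  have "\<omega> \<in> \<O>" unfolding \<omega>_def by (rule coordinates_in_O) simp
  have c\<omega>: "conj \<omega> = of_int D / 2 * (of_int 1 - of_int 1 * s)"
    unfolding \<omega>_def by (rule coordinates_Nm_Tr)
  obtain m n :: int where 1: "1 = of_int m * u + of_int n * v" using basis[OF O_1] by blast
  obtain m' n' :: int where 2: "\<omega> = of_int m' * u + of_int n' * v" using basis[OF \<open>\<omega> \<in> \<O>\<close>] by blast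
  have "conj 1 = of_int m * conj u + of_int n * conj v" unfolding 1 using assms(1,2) by simp
  then have c1: "1 = of_int m * conj u + of_int n * conj v" by simp
  have c2: "conj \<omega> = of_int m' * conj u + of_int n' * conj v" unfolding 2 using assms(1,2) by simp
  define \<delta> where "\<delta> = u * conj v - v * conj u"
  have uv: "u * conj v \<in> \<O>" using assms by simp
  obtain x y :: int where xy: "u * conj v = of_int D / 2 * (of_int x + of_int y * s)"
    using uv by (rule O_coordinates)
  have "conj (u * conj v) = of_int D / 2 * (of_int x - of_int y * s)"
    unfolding xy by (rule coordinates_Nm_Tr)
  then have "v * conj u = of_int D / 2 * (of_int x - of_int y * s)"
    using assms by (simp add: mult.commute)
  then have \<delta>: "\<delta> = of_int (D * y) * s" unfolding \<delta>_def xy by (simp add: field_simps)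
  have "1 * conj \<omega> - \<omega> * 1 = (of_int m * u + of_int n * v) * (of_int m' * conj u + of_int n' * conj v)
      - (of_int m' * u + of_int n' * v) * (of_int m * conj u + of_int n * conj v)"
    using 1 c1 2 c2 by metis
  also have "\<dots> = of_int (m * n' - n * m') * \<delta>" by (simp add: \<delta>_def algebra_simps)
  finally have "conj \<omega> - \<omega> = of_int (m * n' - n * m') * \<delta>" by simp
  moreover have "conj \<omega> - \<omega> = of_int (- D) * s"
    unfolding c\<omega> unfolding \<omega>_def by (simp add: field_simps)
  ultimately have "of_int (- D) * s = of_int ((m * n' - n * m') * (D * y)) * s"
    by (simp add: \<delta>)
  then have "of_int (- D) = (of_int ((m * n' - n * m') * (D * y)) :: real)"
    using s_pos by (simp only: mult_cancel_right) auto
  then have "- D = (m * n' - n * m') * (D * y)" by (simp only: of_int_eq_iff)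
  then have "D * - 1 = D * (y * (m * n' - n * m'))" by (simp add: algebra_simps)
  then have "- 1 = y * (m * n' - n * m')"
    using D_pos mult_left_cancel[of D "- 1" "y * (m * n' - n * m')"] by simp
  then have "y dvd 1" by (metis dvd_minus_iff dvd_triv_left)
  then have "y = 1 \<or> y = - 1" by auto
  then show ?thesis using that[of y] \<delta>[unfolded \<delta>_def] by blast
qed

text \<open>The relation \<open>z\<close> makes \<open>p0\<close> a rational multiple of
  \<open>s * q0\<close>. With vanishing trace, \<alpha> times one of the two is rational, so
  \<alpha> is a rational multiple of the conjugate of that one, whose norm is known.\<close>

lemma ambiguous_case:
  assumes \<alpha>: "\<alpha> \<in> \<O>" "\<alpha> \<noteq> 0" and p: "p0 \<in> \<O>" and q: "q0 \<in> \<O>"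
    and y: "y = 1 \<or> y = - 1" and z: "p0 * conj q0 = of_int (D * y) * s"
    and par: "\<exists>v\<in>\<O>. q0 = p0 + 2 * v"
    and Tr: "Tr ((\<alpha> * p0) * (\<alpha> * q0)) = 0"
    and ineq: "qf (\<alpha> * p0) \<le> 3 * qf (\<alpha> * q0)" "qf (\<alpha> * q0) \<le> 3 * qf (\<alpha> * p0)"
  obtains c g e f where "c \<in> \<rat>" "g \<in> \<O>" "\<alpha> = c * g" "\<bar>Nm g\<bar> = of_int (D * e)"
    "d = e * f" "e > 0" "f > 0" "e \<le> 3 * f" "f \<le> 3 * e"
proof -
  have K: "\<alpha> \<in> K" "p0 \<in> K" "q0 \<in> K" using assms O_K by auto
  have z0: "p0 * conj q0 \<noteq> 0" using z y D_pos s_pos by auto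
  then have nz: "p0 \<noteq> 0" "q0 \<noteq> 0" using K by auto
  obtain a' where a': "Nm p0 = of_int a'" using p by (rule O_Nm_Ints)
  obtain b' where b': "Nm q0 = of_int b'" using q by (rule O_Nm_Ints)
  have "Nm (p0 * conj q0) = of_int (- D * D * d)"
    unfolding z using y by (auto simp: Nm_def s_sq s_sq' algebra_simps)
  then have "of_int (a' * b') = (of_int (- D * D * d) :: real)"
    using K a' b' by (simp add: Nm_mult Nm_conj)
  then have ab': "a' * b' = - D * D * d" by (simp only: of_int_eq_iff)
  \<comment> \<open>For \<open>D = 2\<close>, \<open>q0\<close> and \<open>p0\<close> differ by
    twice an integer, so their norms have equal parity; the product of the norms is even, hence both
    are.\<close>
  have "D dvd a' \<and> D dvd b'"
  proof (cases "D = 1")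
    case False
    then have D2: "D = 2" using D_cases by auto
    obtain v where v: "v \<in> \<O>" "q0 = p0 + 2 * v" using par by blast
    obtain n where n: "Nm v = of_int n" using v(1) by (rule O_Nm_Ints)
    have "p0 * conj v \<in> \<O>" using p v by simp
    then obtain t where t: "Tr (p0 * conj v) = of_int t" using O_iff by (metis Ints_cases)
    have "Nm q0 = Nm p0 + 2 * Tr (p0 * conj v) + 4 * Nm v"
      unfolding v(2) using K v(1) by (simp add: Nm_def Tr_def algebra_simps)
    then have "of_int b' = (of_int (a' + 2 * t + 4 * n) :: real)" using a' b' t n by simp
    then have "b' = a' + 2 * t + 4 * n" by (simp only: of_int_eq_iff)
    then have "even a' \<longleftrightarrow> even b'" by simp
    moreover have "even (a' * b')" unfolding ab' D2 by simp
    ultimately show ?thesis using D2 by auto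
  qed simp
  then obtain a b where ab: "a' = D * a" "b' = D * b" by (meson dvdE)
  have "D * D * (a * b) = D * D * (- d)" using ab' ab by (simp add: mult_ac)
  then have d_ab: "a * b = - d" using D_pos mult_left_cancel[of "D * D" "a * b" "- d"] by simp
  then have d_abs: "d = \<bar>a\<bar> * \<bar>b\<bar>" using d_gt_1 by (simp flip: abs_mult)
  have nz_ab: "a \<noteq> 0" "b \<noteq> 0" using d_ab d_gt_1 by auto
  define P where "P = \<alpha> * p0"
  define Q where "Q = \<alpha> * q0"
  have PQK: "P \<in> K" "Q \<in> K" and PQ0: "P \<noteq> 0" "Q \<noteq> 0" using K \<alpha> nz by (simp_all add: P_def Q_def)
  define \<kappa> where "\<kappa> = of_int y / (of_int b :: real)"
  have \<kappa>: "\<kappa> \<in> \<rat>" "\<kappa> \<noteq> 0" using y nz_ab by (auto simp: \<kappa>_def)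
  have \<kappa>K: "\<kappa> \<in> K" "conj \<kappa> = \<kappa>" using \<kappa> K_Rats by simp_all
  \<comment> \<open>The relation \<open>z\<close> multiplied by \<open>q0\<close>; dividing by the
    norm of \<open>q0\<close> leaves the rational factor \<kappa>, which is \<open>1 / b\<close> up
    to sign.\<close>
  have "p0 * Nm q0 = of_int (D * y) * s * q0" using z by (simp add: Nm_def mult_ac)
  then have "p0 = \<kappa> * (s * q0)"
    using nz_ab D_pos by (simp add: b' ab \<kappa>_def field_simps)
  then have PQ: "P = \<kappa> * (s * Q)" by (simp add: P_def Q_def mult_ac)
  have qfP: "qf P = \<kappa>\<^sup>2 * of_int d * qf Q"
    unfolding PQ using PQK \<kappa>K by (simp add: qf_def s_sq s_sq' power2_eq_square algebra_simps)
  have qfQ0: "qf Q > 0" using PQ0 by (simp add: qf_def add_pos_nonneg)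
  have \<kappa>2: "\<kappa>\<^sup>2 * (of_int b)\<^sup>2 = 1" using y nz_ab by (auto simp: \<kappa>_def power2_eq_square)
  have "\<kappa>\<^sup>2 * of_int d * qf Q \<le> 3 * qf Q" "1 * qf Q \<le> (3 * (\<kappa>\<^sup>2 * of_int d)) * qf Q"
    using ineq unfolding P_def[symmetric] Q_def[symmetric] qfP by simp_all
  then have le: "\<kappa>\<^sup>2 * of_int d \<le> 3" "1 \<le> 3 * (\<kappa>\<^sup>2 * of_int d)"
    using qfQ0 mult_le_cancel_right_pos by blast+
  \<comment> \<open>The ratio of the squared lengths of \<open>P\<close> and \<open>Q\<close> is
    \<open>d / b^2\<close>, that is, the ratio of the absolute values of \<open>a\<close> and
    \<open>b\<close>; the length inequalities thus become the bounds on the factors.\<close>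
  have "\<kappa>\<^sup>2 * of_int d * (of_int b)\<^sup>2 = of_int d"
    using \<kappa>2 by (metis mult.assoc mult.commute mult.right_neutral)
  then have "of_int d \<le> 3 * (of_int b :: real)\<^sup>2" "(of_int b :: real)\<^sup>2 \<le> 3 * of_int d"
    using mult_right_mono[OF le(1) zero_le_power2[of "of_int b"]]
      mult_right_mono[OF le(2) zero_le_power2[of "of_int b"]] by linarith+
  then have "of_int d \<le> (of_int (3 * b\<^sup>2) :: real)" "of_int (b\<^sup>2) \<le> (of_int (3 * d) :: real)"
    by simp_all
  then have "d \<le> 3 * b\<^sup>2" "b\<^sup>2 \<le> 3 * d" by (simp_all only: of_int_le_iff)
  then have "\<bar>b\<bar> * \<bar>a\<bar> \<le> \<bar>b\<bar> * (3 * \<bar>b\<bar>)" "\<bar>b\<bar> * \<bar>b\<bar> \<le> \<bar>b\<bar> * (3 * \<bar>a\<bar>)"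
    unfolding d_abs by (simp_all add: power2_eq_square mult_ac)
  then have bounds: "\<bar>a\<bar> \<le> 3 * \<bar>b\<bar>" "\<bar>b\<bar> \<le> 3 * \<bar>a\<bar>"
    using mult_le_cancel_left_pos[of "\<bar>b\<bar>"] nz_ab(2) zero_less_abs_iff by blast+
  \<comment> \<open>As \<open>conj\<close> changes the sign of \<open>s\<close>, the trace vanishes
    only if \<open>Q\<close> and its conjugate have the same square. Then \<open>Q\<close> or
    \<open>s * Q\<close> is rational.\<close>
  have "Tr (\<kappa> * (s * Q) * Q) = 0" using Tr unfolding P_def[symmetric] Q_def[symmetric] PQ .
  then have "\<kappa> * (s * (Q * Q - conj Q * conj Q)) = 0"
    using PQK \<kappa>K by (simp add: Tr_def algebra_simps)
  then have "conj Q * conj Q = Q * Q" using \<kappa> s_pos by simp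
  then have cQ: "conj Q = Q \<or> conj Q = - Q" by (simp add: square_eq_iff)
  have divide: "\<exists>c g. c \<in> \<rat> \<and> g \<in> \<O> \<and> \<alpha> = c * g \<and> \<bar>Nm g\<bar> = \<bar>Nm h\<bar>"
    if h: "h \<in> \<O>" "\<alpha> * h \<in> \<rat>" "h \<noteq> 0" for h
  proof (intro exI conjI)
    show "\<alpha> * h / Nm h \<in> \<rat>" using h Nm_Rats[of h] by simp
    show "conj h \<in> \<O>" using h by simp
    show "\<alpha> = \<alpha> * h / Nm h * conj h" using h Nm_eq_0_iff[of h] by (simp add: Nm_def)
    show "\<bar>Nm (conj h)\<bar> = \<bar>Nm h\<bar>" using h by (simp add: Nm_conj)
  qed
  from cQ show ?thesis
  proof
    assume "conj Q = Q"
    then have "Q \<in> \<rat>" using PQK conj_fixed by blast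
    then obtain c g where "c \<in> \<rat>" "g \<in> \<O>" "\<alpha> = c * g" "\<bar>Nm g\<bar> = \<bar>Nm q0\<bar>"
      using divide q nz unfolding Q_def by blast
    moreover have "\<bar>Nm q0\<bar> = of_int (D * \<bar>b\<bar>)" using b' ab D_pos by (simp add: abs_mult)
    ultimately show ?thesis using that[of c g "\<bar>b\<bar>" "\<bar>a\<bar>"] d_abs nz_ab bounds by (simp add: mult.commute)
  next
    assume cQ: "conj Q = - Q"
    have "conj P = P" unfolding PQ using PQK \<kappa>K cQ by simp
    then have "P \<in> \<rat>" using PQK conj_fixed by blast
    then obtain c g where "c \<in> \<rat>" "g \<in> \<O>" "\<alpha> = c * g" "\<bar>Nm g\<bar> = \<bar>Nm p0\<bar>"
      using divide p nz unfolding P_def by blast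
    moreover have "\<bar>Nm p0\<bar> = of_int (D * \<bar>a\<bar>)" using a' ab D_pos by (simp add: abs_mult)
    ultimately show ?thesis using that[of c g "\<bar>a\<bar>" "\<bar>b\<bar>"] d_abs nz_ab bounds by simp
  qed
qed

text \<open>The lattice is hexagonal here and the six minimal vectors contain several bases; the given
  one need not be compatible with conjugation.\<close>

lemma hexagonal_case:
  assumes d3: "d = 3" and \<alpha>: "\<alpha> \<in> \<O>" "\<alpha> \<noteq> 0" and p: "p0 \<in> \<O>" and q: "q0 \<in> \<O>"
    and X: "X = 3 \<or> X = - 3" and Y: "Y = 2 \<or> Y = - 2"
    and z: "p0 * conj q0 = of_int X + of_int Y * s" and Nm: "\<bar>Nm p0\<bar> = 1"
    and Tr: "Tr ((\<alpha> * p0) * (\<alpha> * q0)) = 0"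
  obtains c g e f where "c \<in> \<rat>" "g \<in> \<O>" "\<alpha> = c * g" "\<bar>Nm g\<bar> = of_int (D * e)"
    "d = e * f" "e > 0" "f > 0" "e \<le> 3 * f" "f \<le> 3 * e"
proof -
  have "d mod 4 = 3" using d3 by simp
  then have D2: "D = 2" using D_cases by auto
  have K: "\<alpha> \<in> K" "p0 \<in> K" "q0 \<in> K" using assms O_K by auto
  have N: "Nm p0 = 1 \<or> Nm p0 = - 1" using Nm by linarith
  define P where "P = \<alpha> * p0"
  have PK: "P \<in> K" using K by (simp add: P_def)
  \<comment> \<open>Because \<open>p0\<close> has norm \<open>1\<close> or \<open>-1\<close>,
    \<open>q0\<close> is determined by \<open>p0\<close> and the conjugate of
    \<open>p0 * conj q0\<close>; the trace condition becomes a condition on \<open>P\<close>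
    alone.\<close>
  have "q0 * conj p0 = conj (p0 * conj q0)" using K by (simp add: mult.commute)
  also have "\<dots> = of_int X - of_int Y * s" unfolding z by (simp add: conj_eq del: conj_add)
  finally have "q0 * Nm p0 = (of_int X - of_int Y * s) * p0" by (simp add: Nm_def mult_ac)
  then have "(\<alpha> * p0) * (\<alpha> * q0) * Nm p0 = P * P * (of_int X - of_int Y * s)"
    unfolding P_def by (metis mult.assoc mult.commute)
  moreover have "Tr ((\<alpha> * p0) * (\<alpha> * q0) * Nm p0) = 0" using N Tr K by (auto simp: Tr_def)
  ultimately have Tr0: "Tr (P * P * (of_int X - of_int Y * s)) = 0" by simp
  obtain x y where xy: "x \<in> \<rat>" "y \<in> \<rat>" "P = x + y * s" using PK by (rule K_E)
  have s3: "s * s = 3" "\<And>t. s * (s * t) = 3 * t" using s_sq s_sq' d3 by simp_all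
  have cP: "conj P = x - y * s" using xy by (simp add: conj_eq del: conj_add)
  have "Tr (P * P * (of_int X - of_int Y * s)) = 2 * (of_int X * (x * x + 3 * y * y) - 6 * (of_int Y * (x * y)))"
    unfolding Tr_def using PK by (simp add: cP) (simp add: xy(3) algebra_simps s3)
  then have eq: "of_int X * (x * x + 3 * y * y) - 6 * (of_int Y * (x * y)) = 0" using Tr0 by simp
  \<comment> \<open>The common sign of \<open>X\<close> and \<open>Y\<close> in the quadratic form,
    which then factors with roots \<open>x = \<sigma> * y\<close> and
    \<open>x = 3 * \<sigma> * y\<close>.\<close>
  define \<sigma> :: int where "\<sigma> = (X div 3) * (Y div 2)"
  have \<sigma>: "\<sigma> = 1 \<or> \<sigma> = - 1" using X Y by (auto simp: \<sigma>_def)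
  have "x * x + 3 * y * y - 4 * (of_int \<sigma> * (x * y)) = 0"
    using eq X Y by (auto simp: \<sigma>_def)
  moreover have "(x - of_int \<sigma> * y) * (x - of_int (3 * \<sigma>) * y) = x * x + 3 * y * y - 4 * (of_int \<sigma> * (x * y))"
    using \<sigma> by (auto simp: algebra_simps)
  ultimately have "x = of_int \<sigma> * y \<or> x = of_int (3 * \<sigma>) * y" by auto
  then obtain e :: int where e: "e = 1 \<or> e = 3" "x = of_int (e * \<sigma>) * y" by fastforce
  define h where "h = of_int (e * \<sigma>) + s"
  have hO: "h \<in> \<O>" unfolding h_def by simp
  have "\<bar>Nm h\<bar> = of_int (D * e)"
    unfolding h_def Nm_def using e(1) \<sigma> D2 by (auto simp: s3 algebra_simps)
  moreover have Ph: "P = y * h" using xy(3) e(2) by (simp add: h_def algebra_simps)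
  ultimately have N': "\<bar>Nm (h * conj p0)\<bar> = of_int (D * e)"
    using hO p Nm by (simp add: Nm_mult Nm_conj abs_mult)
  have "\<alpha> * Nm p0 = P * conj p0" by (simp add: P_def Nm_def)
  then have "\<alpha> = Nm p0 * y * (h * conj p0)" using N Ph by (auto simp: algebra_simps)
  moreover have "Nm p0 * y \<in> \<rat>" using xy Nm_Rats K by simp
  moreover have "h * conj p0 \<in> \<O>" using hO p by simp
  \<comment> \<open>With \<open>d = 3\<close> and \<open>e\<close> equal to \<open>1\<close> or
    \<open>3\<close>, the cofactor of \<open>e\<close> is \<open>4 - e\<close>.\<close>
  ultimately show ?thesis
    using that[of "Nm p0 * y" "h * conj p0" e "4 - e"] N' e(1) d3 by auto
qed


text \<open>Writing \<open>X = d * Z\<close> and \<open>w = W\<close>, the norm condition reads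
  \<open>D^2 * d * Z^2 + 4 * W^2 = 4 * D^2\<close>. Since \<open>W\<close> is nonzero and
  \<open>d\<close> is at least \<open>3\<close>, a nonzero \<open>Z\<close> survives only for
  \<open>d = 3\<close>, \<open>D = 2\<close>.\<close>

lemma minimal_pair_dichotomy:
  fixes X y :: int
  assumes z: "z = of_int D / 2 * (of_int X + of_int (2 * y) * s)" and y: "y = 1 \<or> y = - 1"
    and w: "w \<in> \<rat>" "w \<noteq> 0" "Nm z = - of_int d * w\<^sup>2" and "z \<in> \<O>"
  shows "X = 0 \<or> d = 3 \<and> D = 2 \<and> (X = 3 \<or> X = - 3)"
proof -
  have yy: "y\<^sup>2 = 1" using y by auto
  obtain n where n: "Nm z = of_int n" using \<open>z \<in> \<O>\<close> by (rule O_Nm_Ints)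
  have "of_int d * w\<^sup>2 \<in> \<int>" using w(3) n by (metis Ints_minus Ints_of_int minus_minus mult_minus_left)
  then have "w \<in> \<int>" using w(1) rat_square_int by blast
  then obtain W :: int where W: "w = of_int W" by (auto elim: Ints_cases)
  have W0: "W\<^sup>2 \<ge> 1" using w(2) W by (simp add: int_one_le_iff_zero_less)
  have "4 * Nm z = of_int (D\<^sup>2 * (X\<^sup>2 - d * (2 * y)\<^sup>2))" unfolding z by (rule coordinates_Nm_Tr)
  then have "of_int (D\<^sup>2 * (X\<^sup>2 - d * (2 * y)\<^sup>2)) = (of_int (- 4 * d * W\<^sup>2) :: real)"
    using w(3) W by simp
  then have "D\<^sup>2 * (X\<^sup>2 - d * (2 * y)\<^sup>2) = - 4 * d * W\<^sup>2" by (simp only: of_int_eq_iff)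
  then have eq: "D\<^sup>2 * X\<^sup>2 = d * (4 * D\<^sup>2 - 4 * W\<^sup>2)"
    using yy by (simp add: power_mult_distrib algebra_simps)
  have "Rings.coprime d (D\<^sup>2)" using odd_d D_cases by auto
  then have "d dvd X\<^sup>2" using eq by (metis coprime_dvd_mult_right_iff dvd_triv_left)
  then have "d dvd X" using squarefree_d squarefree_dvd_square by blast
  then obtain Z where Z: "X = d * Z" by (elim dvdE)
  have "d * (D\<^sup>2 * (d * Z\<^sup>2)) = d * (4 * D\<^sup>2 - 4 * W\<^sup>2)"
    using eq unfolding Z by (simp add: power2_eq_square algebra_simps)
  then have eq': "D\<^sup>2 * (d * Z\<^sup>2) + 4 * W\<^sup>2 = 4 * D\<^sup>2" using d_gt_1 by simp
  show ?thesis
  proof (cases "Z = 0")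
    case False
    then have Z1: "Z\<^sup>2 \<ge> 1" by (simp add: int_one_le_iff_zero_less)
    then have dZ: "d * Z\<^sup>2 \<ge> d" using d_gt_1 by (simp add: mult_le_cancel_left1)
    have D2: "D = 2"
    proof (rule ccontr)
      assume "D \<noteq> 2"
      then have "D = 1" using D_cases by auto
      then show False using eq' W0 dZ d_gt_1 by simp
    qed
    then have sum: "d * Z\<^sup>2 + W\<^sup>2 = 4" using eq' by simp
    then have d3: "d = 3" using W0 dZ d_ge_3 by linarith
    then have "3 * Z\<^sup>2 + W\<^sup>2 = 4" using sum by simp
    then have "Z\<^sup>2 = 1" using Z1 W0 by linarith
    then have "Z = 1 \<or> Z = - 1" by (simp add: power2_eq_1_iff)
    then show ?thesis using Z d3 D2 by auto
  qed (simp add: Z)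
qed

text \<open>Both the necessity of the norm equation and the shape of primitive ideals follow from
  this one description.\<close>

lemma PWR_ideal_form:
  assumes "PWR_ideal d I"
  obtains c g e f where "c \<in> \<rat>" "c \<noteq> 0" "g \<in> \<O>" "\<bar>Nm g\<bar> = of_int (D * e)"
    "d = e * f" "e > 0" "f > 0" "e \<le> 3 * f" "f \<le> 3 * e" "I = (\<lambda>z. c * z) ` J (D * e)"
proof -
  have pid: "principalideal I R" and I0: "I \<noteq> {0}" and WR: "WR_lattice (Lambda d ` I)"
    using assms by (simp_all add: PWR_ideal_def)
  have idl: "ideal I R" using pid by (simp add: principalideal_def)
  note I = ideal_RD[OF idl]
  have IK: "I \<subseteq> K" using I(1) O_K by blast
  obtain \<alpha> where \<alpha>: "\<alpha> \<in> \<O>" and I_\<alpha>: "I = {x * \<alpha> | x. x \<in> \<O>}"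
    using pid principalideal_R_iff by blast
  have \<alpha>0: "\<alpha> \<noteq> 0"
  proof
    assume "\<alpha> = 0"
    then have "I = {0}" unfolding I_\<alpha> by (auto intro: exI[of _ 1])
    then show False using I0 by simp
  qed
  obtain u v where uv: "u \<in> minimal_elements I" "v \<in> minimal_elements I" "u * conj v \<noteq> v * conj u"
    using WR WR_lattice_Lambda_iff[OF IK] by blast
  then have uvI: "u \<in> I" "v \<in> I" by (simp_all add: minimal_elements_def)
  obtain u0 where u0: "u0 \<in> \<O>" "u = u0 * \<alpha>" using uvI(1) unfolding I_\<alpha> by blast
  obtain v0 where v0: "v0 \<in> \<O>" "v = v0 * \<alpha>" using uvI(2) unfolding I_\<alpha> by blast
  have basis: "\<exists>m n::int. z = of_int m * u0 + of_int n * v0" if "z \<in> \<O>" for z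
  proof -
    have "z * \<alpha> \<in> I" unfolding I_\<alpha> using that by blast
    then obtain m n :: int where "z * \<alpha> = of_int m * u + of_int n * v"
      using idl uv by (metis minimal_elements_basis)
    then have "z * \<alpha> = (of_int m * u0 + of_int n * v0) * \<alpha>" by (simp add: u0 v0 algebra_simps)
    then show ?thesis using \<alpha>0 by auto
  qed
  obtain y :: int where \<delta>: "u0 * conj v0 - v0 * conj u0 = of_int (D * y) * s" and y: "y = 1 \<or> y = - 1"
    using u0(1) v0(1) basis by (rule O_basis_determinant)
  \<comment> \<open>After multiplication by \<alpha> these are the diagonals of the rhombus spanned
    by the two minimal vectors.\<close>
  define p0 where "p0 = u0 - v0"
  define q0 where "q0 = u0 + v0"
  have O: "p0 \<in> \<O>" "q0 \<in> \<O>" using u0 v0 by (simp_all add: p0_def q0_def)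
  have K: "\<alpha> \<in> K" "u0 \<in> K" "v0 \<in> K" "p0 \<in> K" "q0 \<in> K" using O \<alpha> u0 v0 O_K by blast+
  define z where "z = p0 * conj q0"
  have zO: "z \<in> \<O>" using O by (simp add: z_def)
  obtain X Y :: int where XY: "z = of_int D / 2 * (of_int X + of_int Y * s)"
    using zO by (rule O_coordinates)
  have cz: "conj z = of_int D / 2 * (of_int X - of_int Y * s)" unfolding XY by (rule coordinates_Nm_Tr)
  \<comment> \<open>This difference is twice the basis determinant, which fixes the irrational
    coordinate of \<open>z\<close>.\<close>
  have "z - conj z = 2 * (u0 * conj v0 - v0 * conj u0)"
    unfolding z_def p0_def q0_def using K by (simp add: algebra_simps)
  then have zc: "z - conj z = of_int (D * (2 * y)) * s" unfolding \<delta> by simp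
  moreover have "z - conj z = of_int (D * Y) * s" unfolding cz unfolding XY by (simp add: algebra_simps)
  ultimately have "of_int (D * Y) * s = of_int (D * (2 * y)) * s" by simp
  then have "of_int (D * Y) = (of_int (D * (2 * y)) :: real)"
    using s_pos by (simp only: mult_cancel_right) auto
  then have "D * Y = D * (2 * y)" by (simp only: of_int_eq_iff)
  then have Y: "Y = 2 * y" using D_pos by simp
  define P where "P = \<alpha> * p0"
  define Q where "Q = \<alpha> * q0"
  have P: "P = u - v" and Q: "Q = u + v" by (simp_all add: P_def Q_def p0_def q0_def u0 v0 algebra_simps)
  have PQK: "P \<in> K" "Q \<in> K" using K by (simp_all add: P_def Q_def)
  have uvK: "u \<in> K" "v \<in> K" using uvI IK by auto
  \<comment> \<open>\<open>Tr (P * Q)\<close> is the inner product of the diagonals, and the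
    diagonals of a rhombus are perpendicular. So \<open>P * Q\<close> is a rational multiple of
    \<open>s\<close>, and its norm is \<open>- d\<close> times a rational square.\<close>
  have "qf u = qf v" using uv by (auto simp: minimal_elements_def intro!: order.antisym)
  then have TrPQ: "Tr (P * Q) = 0"
    unfolding P Q using uvK by (simp add: Tr_def qf_def power2_eq_square algebra_simps)
  have "z \<noteq> 0" using zc y D_pos s_pos by auto
  then have nz: "p0 \<noteq> 0" "q0 \<noteq> 0" by (auto simp: z_def)
  then have PQ0: "P \<noteq> 0" "Q \<noteq> 0" using \<alpha>0 by (simp_all add: P_def Q_def)
  obtain r where r: "r \<in> \<rat>" "P * Q = r * s" using PQK TrPQ Tr_eq_0[of "P * Q"] by auto
  have r0: "r \<noteq> 0" using r PQ0 by auto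
  define w where "w = r / Nm \<alpha>"
  have N\<alpha>: "Nm \<alpha> \<in> \<rat>" "Nm \<alpha> \<noteq> 0" using K Nm_Rats Nm_eq_0_iff \<alpha>0 by auto
  have w: "w \<in> \<rat>" "w \<noteq> 0" using r N\<alpha> r0 by (simp_all add: w_def)
  have "Nm (P * Q) = - of_int d * r\<^sup>2"
    unfolding r(2) using r(1) by (simp add: Nm_def K_Rats s_sq power2_eq_square mult_ac)
  moreover have "Nm (P * Q) = (Nm \<alpha>)\<^sup>2 * Nm z"
    unfolding P_def Q_def z_def using K by (simp add: Nm_mult Nm_conj power2_eq_square mult_ac)
  ultimately have Nz: "Nm z = - of_int d * w\<^sup>2" using N\<alpha> by (simp add: w_def power_divide field_simps)
  have cases: "X = 0 \<or> d = 3 \<and> D = 2 \<and> (X = 3 \<or> X = - 3)"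
    by (rule minimal_pair_dichotomy) (use XY Y y w Nz zO in auto)
  have "\<exists>c g e f. c \<in> \<rat> \<and> g \<in> \<O> \<and> \<alpha> = c * g \<and> \<bar>Nm g\<bar> = of_int (D * e)
      \<and> d = e * f \<and> e > 0 \<and> f > 0 \<and> e \<le> 3 * f \<and> f \<le> 3 * e"
    using cases
  proof
    assume "X = 0"
    then have z': "p0 * conj q0 = of_int (D * y) * s" using XY Y by (simp add: z_def)
    have PQI: "P \<in> I" "Q \<in> I" unfolding P Q using I(3)[OF uvI] I(3)[OF uvI(1) I(5)[OF uvI(2)]] by simp_all
    have qu: "qf u \<le> qf P" "qf u \<le> qf Q" using uv PQI PQ0 by (auto simp: minimal_elements_def)
    \<comment> \<open>Parallelogram law: the squared diagonals add up to four times the minimum and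
      each is at least the minimum, so neither exceeds three times the other.\<close>
    have "qf P + qf Q = 2 * qf u + 2 * qf v"
      unfolding P Q using uvK by (simp add: qf_def power2_eq_square algebra_simps)
    then have ineq: "qf P \<le> 3 * qf Q" "qf Q \<le> 3 * qf P" using qu \<open>qf u = qf v\<close> by linarith+
    have par: "\<exists>v\<in>\<O>. q0 = p0 + 2 * v" using v0(1) by (intro bexI[of _ v0]) (simp_all add: p0_def q0_def)
    show ?thesis
      using ambiguous_case[OF \<alpha> \<alpha>0 O y z' par TrPQ[unfolded P_def Q_def] ineq[unfolded P_def Q_def]]
      by metis
  next
    assume hex: "d = 3 \<and> D = 2 \<and> (X = 3 \<or> X = - 3)"
    have X3: "X = 3 \<or> X = - 3" and d3: "d = 3" and D2: "D = 2" using hex by blast+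
    have z1: "p0 * conj q0 = of_int X + of_int Y * s" using XY D2 by (simp add: z_def)
    have "conj (p0 * conj q0) = of_int X + of_int (- Y) * s" using cz D2 by (simp add: z_def)
    then have z2: "q0 * conj p0 = of_int X + of_int (- Y) * s" using K by (simp add: mult.commute)
    have Y2: "Y = 2 \<or> Y = - 2" "- Y = 2 \<or> - Y = - 2" using Y y by auto
    have "4 * Nm z = of_int (D\<^sup>2 * (X\<^sup>2 - d * Y\<^sup>2))" unfolding XY by (rule coordinates_Nm_Tr)
    also have "D\<^sup>2 * (X\<^sup>2 - d * Y\<^sup>2) = - 12" unfolding D2 using X3 Y2 hex by auto
    finally have Nz3: "Nm z = - 3" by simp
    \<comment> \<open>The integral norms of \<open>p0\<close> and \<open>q0\<close> multiply to
      \<open>-3\<close>, so one of them is \<open>1\<close> or \<open>-1\<close>. If it belongs to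
      \<open>q0\<close>, the roles are exchanged, which conjugates \<open>z\<close> and changes the
      sign of \<open>Y\<close>.\<close>
    obtain a b where ab: "Nm p0 = of_int a" "Nm q0 = of_int b" using O O_Nm_Ints by metis
    have "of_int (a * b) = (of_int (- 3) :: real)" using Nz3 ab K by (simp add: z_def Nm_mult Nm_conj)
    then have "a * b = - 3" by (simp only: of_int_eq_iff)
    then have "a dvd 3" by (metis dvd_minus_iff dvd_triv_left)
    then have "\<bar>a\<bar> \<le> 3" using dvd_imp_le_int[of 3 a] by simp
    then have "a = - 3 \<or> a = - 2 \<or> a = - 1 \<or> a = 0 \<or> a = 1 \<or> a = 2 \<or> a = 3" by linarith
    then have "\<bar>a\<bar> = 1 \<or> \<bar>b\<bar> = 1" using \<open>a * b = - 3\<close> by (elim disjE; hypsubst; presburger)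
    then have "\<bar>Nm p0\<bar> = 1 \<or> \<bar>Nm q0\<bar> = 1" using ab by auto
    then show ?thesis
    proof
      assume N: "\<bar>Nm p0\<bar> = 1"
      show ?thesis
        using hexagonal_case[OF d3 \<alpha> \<alpha>0 O X3 Y2(1) z1 N TrPQ[unfolded P_def Q_def]] by metis
    next
      assume N: "\<bar>Nm q0\<bar> = 1"
      have T: "Tr ((\<alpha> * q0) * (\<alpha> * p0)) = 0" using TrPQ by (simp add: P_def Q_def mult.commute)
      show ?thesis
        using hexagonal_case[OF d3 \<alpha> \<alpha>0 O(2,1) X3 Y2(2) z2 N T] by metis
    qed
  qed
  then obtain c g e f where *: "c \<in> \<rat>" "g \<in> \<O>" "\<alpha> = c * g" "\<bar>Nm g\<bar> = of_int (D * e)"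
    "d = e * f" "e > 0" "f > 0" "e \<le> 3 * f" "f \<le> 3 * e" by blast
  have "J (D * e) = {x * g | x. x \<in> \<O>}"
    by (rule J_eq_principal) (use * D_pos in auto)
  then have "I = (\<lambda>z. c * z) ` J (D * e)" unfolding I_\<alpha> *(3) by (auto simp: mult_ac)
  moreover have "c \<noteq> 0" using *(3) \<alpha>0 by auto
  ultimately show ?thesis using * that by blast
qed

section \<open>The norm equation: from generators to factorizations and back\<close>

lemma PWR_factorization_of_norm:
  assumes g: "g \<in> \<O>" "\<bar>Nm g\<bar> = of_int (D * e)"
    and d: "d = e * f" and pos: "e > 0" "f > 0" and le: "e \<le> 3 * f" "f \<le> 3 * e"
  shows "PWR_factorization d (min e f) (max e f)"
proof -
  have Nm: "Nm g = of_int (D * e) \<or> Nm g = of_int (- (D * e))" using g(2) by auto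
  then have "g \<in> J (D * e)" using g(1) by (auto simp: J_iff simp del: of_int_mult of_int_minus)
  then obtain x y :: int where xy: "g = of_int D / 2 * (of_int (e * x) + of_int y * s)"
    using J_coordinates[OF d pos(1)] by blast
  have "4 * Nm g = of_int (D\<^sup>2 * ((e * x)\<^sup>2 - d * y\<^sup>2))" unfolding xy by (rule coordinates_Nm_Tr)
  then have "of_int (D\<^sup>2 * ((e * x)\<^sup>2 - d * y\<^sup>2)) = (of_int (4 * (D * e)) :: real)
      \<or> of_int (D\<^sup>2 * ((e * x)\<^sup>2 - d * y\<^sup>2)) = (of_int (- (4 * (D * e))) :: real)"
    using Nm by auto
  then have "D\<^sup>2 * ((e * x)\<^sup>2 - d * y\<^sup>2) = 4 * (D * e) \<or> D\<^sup>2 * ((e * x)\<^sup>2 - d * y\<^sup>2) = - (4 * (D * e))"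
    by (simp only: of_int_eq_iff)
  moreover have "D\<^sup>2 * ((e * x)\<^sup>2 - d * y\<^sup>2) = (D * e) * (D * (x\<^sup>2 * e - y\<^sup>2 * f))"
    by (simp add: d power2_eq_square algebra_simps)
  moreover define E where "E = D * (x\<^sup>2 * e - y\<^sup>2 * f)"
  ultimately have "(D * e) * E = 4 * (D * e) \<or> (D * e) * E = - (4 * (D * e))" by (simp only:)
  then have "(D * e) * (E - 4) = 0 \<or> (D * e) * (E + 4) = 0" by (simp only: algebra_simps) auto
  \<comment> \<open>Both cases of the equation at once: dividing by \<open>D\<close> leaves
    \<open>2\<close> up to sign for \<open>D = 2\<close> and \<open>4\<close> up to sign for
    \<open>D = 1\<close>.\<close>
  then have eq: "D * (x\<^sup>2 * e - y\<^sup>2 * f) = 4 \<or> D * (x\<^sup>2 * e - y\<^sup>2 * f) = - 4"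
    using D_pos pos unfolding E_def[symmetric] by auto
  have ne: "e \<noteq> f"
  proof
    assume "e = f"
    then have "e\<^sup>2 dvd d" using d by (simp add: power2_eq_square)
    then have "e dvd 1" using squarefree_d squarefreeD by blast
    then show False using d \<open>e = f\<close> pos d_gt_1 by simp
  qed
  show ?thesis
  proof (cases "e < f")
    case True
    have "\<exists>k l. (d mod 4 = 3 \<longrightarrow> k\<^sup>2 * f - l\<^sup>2 * e = 2 \<or> k\<^sup>2 * f - l\<^sup>2 * e = - 2) \<and>
        (d mod 4 = 1 \<longrightarrow> k\<^sup>2 * f - l\<^sup>2 * e = 4 \<or> k\<^sup>2 * f - l\<^sup>2 * e = - 4)"
      using D_cases eq by (intro exI[of _ y] exI[of _ x]) auto
    then show ?thesis using True d pos le by (simp add: PWR_factorization_def)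
  next
    case False
    have "\<exists>k l. (d mod 4 = 3 \<longrightarrow> k\<^sup>2 * e - l\<^sup>2 * f = 2 \<or> k\<^sup>2 * e - l\<^sup>2 * f = - 2) \<and>
        (d mod 4 = 1 \<longrightarrow> k\<^sup>2 * e - l\<^sup>2 * f = 4 \<or> k\<^sup>2 * e - l\<^sup>2 * f = - 4)"
      using D_cases eq by (intro exI[of _ x] exI[of _ y]) auto
    then show ?thesis using False ne d pos le by (simp add: PWR_factorization_def mult.commute)
  qed
qed

text \<open>A solution of the equation supplies the coordinates of an integer of norm
  \<open>D * e\<close> up to sign, which generates the ideal; well-roundedness uses only the bounds
  on the factors.\<close>

lemma PWR_ideal_of_factorization:
  assumes "PWR_factorization d e f"
  shows "PWR_ideal d (J (D * e))"
proof -
  obtain k l where pos: "e > 0" "f > 0" and d: "d = e * f" and le: "e \<le> 3 * f" "f \<le> 3 * e"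
    and kl: "d mod 4 = 3 \<longrightarrow> k\<^sup>2 * f - l\<^sup>2 * e = 2 \<or> k\<^sup>2 * f - l\<^sup>2 * e = - 2"
      "d mod 4 = 1 \<longrightarrow> k\<^sup>2 * f - l\<^sup>2 * e = 4 \<or> k\<^sup>2 * f - l\<^sup>2 * e = - 4"
    using assms by (auto simp: PWR_factorization_def)
  have eq: "D * (l\<^sup>2 * e - k\<^sup>2 * f) = 4 \<or> D * (l\<^sup>2 * e - k\<^sup>2 * f) = - 4"
    using kl D_cases by auto
  have odd: "odd e" "odd f" using odd_d d by auto
  define g where "g = of_int D / 2 * (of_int (e * l) + of_int k * s)"
  \<comment> \<open>For \<open>D = 1\<close> the equation itself forces the parity required of an
    integer, as both factors are odd.\<close>
  have par: "even (e * l + k)" if "D = 1"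
  proof -
    have "l\<^sup>2 * e - k\<^sup>2 * f = 2 * 2 \<or> l\<^sup>2 * e - k\<^sup>2 * f = 2 * - 2" using eq that by simp
    then have "even (l\<^sup>2 * e - k\<^sup>2 * f)" by (metis dvd_triv_left)
    then show ?thesis using odd by simp
  qed
  have gO: "g \<in> \<O>" unfolding g_def using par by (rule coordinates_in_O)
  have "4 * Nm g = of_int (D\<^sup>2 * ((e * l)\<^sup>2 - d * k\<^sup>2))" unfolding g_def by (rule coordinates_Nm_Tr)
  also have "D\<^sup>2 * ((e * l)\<^sup>2 - d * k\<^sup>2) = (D * e) * (D * (l\<^sup>2 * e - k\<^sup>2 * f))"
    by (simp add: d power2_eq_square algebra_simps)
  finally have "\<bar>4 * Nm g\<bar> = of_int \<bar>(D * e) * (D * (l\<^sup>2 * e - k\<^sup>2 * f))\<bar>" by simp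
  also have "\<bar>(D * e) * (D * (l\<^sup>2 * e - k\<^sup>2 * f))\<bar> = 4 * (D * e)"
    unfolding abs_mult[of "D * e"] using eq D_pos pos by auto
  finally have Nm: "\<bar>Nm g\<bar> = of_int (D * e)" by (simp add: abs_mult)
  have dvd: "D * e dvd D * d" by (simp add: d)
  have J: "J (D * e) = {x * g | x. x \<in> \<O>}"
    using dvd _ gO Nm by (rule J_eq_principal) (use D_pos pos in simp)
  have "g \<noteq> 0" using Nm D_pos pos by (auto simp: Nm_def)
  moreover have "g \<in> J (D * e)" unfolding J using O_1 by force
  ultimately have "J (D * e) \<noteq> {0}" by auto
  moreover have "principalideal (J (D * e)) R" using J gO principalideal_R_iff by blast
  ultimately show ?thesis using WR_lattice_J[OF d pos le] by (simp add: PWR_ideal_def)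
qed

end

theorem theorem3p1:
  fixes d :: int
  assumes "d > 1" and "odd d" and "squarefree d"
  shows "((\<exists>I. PWR_ideal d I) \<longleftrightarrow> (\<exists>d1 d2. PWR_factorization d d1 d2))
    \<and> (\<forall>I. PWR_ideal d I \<and> primitive_ideal d I \<longrightarrow>
         (\<exists>d1 d2. PWR_factorization d d1 d2 \<and> (I = ram_ideal d d1 \<or> I = ram_ideal d d2)))
    \<and> (\<forall>d1 d2. PWR_factorization d d1 d2 \<longrightarrow>
         similar_ideals d (ram_ideal d d1) (ram_ideal d d2))"
proof -
  interpret odd_quadratic_field d using assms by unfold_locales
  show ?thesis
  proof (intro conjI allI impI iffI)
    assume "\<exists>I. PWR_ideal d I"
    then show "\<exists>d1 d2. PWR_factorization d d1 d2"
      using PWR_ideal_form PWR_factorization_of_norm by metis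
  next
    assume "\<exists>d1 d2. PWR_factorization d d1 d2"
    then show "\<exists>I. PWR_ideal d I" using PWR_ideal_of_factorization by blast
  next
    fix I assume I: "PWR_ideal d I \<and> primitive_ideal d I"
    then obtain c g e f where *: "c \<in> \<rat>" "c \<noteq> 0" "g \<in> \<O>" "\<bar>Nm g\<bar> = of_int (D * e)"
      "d = e * f" "e > 0" "f > 0" "e \<le> 3 * f" "f \<le> 3 * e" "I = (\<lambda>z. c * z) ` J (D * e)"
      using PWR_ideal_form by blast
    have "I = J (D * e)" using primitive_multiple_of_J *(5,6,1,2,10) I by blast
    also have "\<dots> = ram_ideal d e" using ram_ideal_eq_J[OF _ *(6)] *(5) dvd_triv_left by metis
    \<comment> \<open>The factor \<open>e\<close> may be the smaller or the larger one, hence the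
      two alternatives.\<close>
    finally have "I = ram_ideal d (min e f) \<or> I = ram_ideal d (max e f)" by (simp add: min_def max_def)
    then show "\<exists>d1 d2. PWR_factorization d d1 d2 \<and> (I = ram_ideal d d1 \<or> I = ram_ideal d d2)"
      using PWR_factorization_of_norm *(3-9) by blast
  next
    fix d1 d2 assume "PWR_factorization d d1 d2"
    then have d: "d = d1 * d2" "d1 > 0" "d2 > 0" by (simp_all add: PWR_factorization_def)
    then show "similar_ideals d (ram_ideal d d1) (ram_ideal d d2)"
      using similar_ideals_J[OF d] ram_ideal_eq_J[OF _ d(2)] ram_ideal_eq_J[OF _ d(3)]
        dvd_triv_left dvd_triv_right by metis
  qed
qed

end
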